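(* Let $\mathbb{G}$ be a homogeneous group of homogeneous dimension $Q\ge 2$, let $|\cdot|$ be any homogeneous quasi-norm on $\mathbb{G}$, let $R>0$ and $B(0,R)=\{x\in\mathbb{G}:|x|<R\}$. Then there exists a constant $C>0$ such that for all real-valued functions $u\in C_0^\infty(B(0,R))$ we have $$\int_{B(0,R)}|\mathcal{R}u(x)|^Q\,dx-\left(\frac{Q-1}{Q}\right)^Q\int_{B(0,R)}\frac{|u(x)|^Q}{|x|^Q\left(\log\frac{R}{|x|}\right)^Q}\,dx\ \ge\ C\,\sup_{T>0}d_{cH}(u;T,R)^Q,$$ where $\mathcal{R}=\frac{d}{d|x|}$ is the radial derivative and, for $T>0$, $$f_{T,R}(x)=T^{\frac{Q-1}{Q}}\,u\!\left(Re^{-\frac1T}\frac{x}{|x|}\right)\left(\log\frac{R}{|x|}\right)^{\frac{Q-1}{Q}},$$ $$d_{cH}(u;T,R):=\left(\int_{B(0,R)}\frac{|u(x)-f_{T,R}(x)|^Q}{|x|^Q\left|\log\frac{R}{|x|}\right|^Q\left|\log\!\left(T\log\frac{R}{|x|}\right)\right|^Q}\,dx\right)^{1/Q}.$$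
   Context: A homogeneous group $\mathbb{G}$ is a connected, simply connected Lie group whose Lie algebra $\mathfrak{g}$ is equipped with a family of dilations $D_\lambda=\mathrm{Exp}(A\ln\lambda)=\sum_{k\ge 0}\frac{1}{k!}(\ln(\lambda)A)^k$, $\lambda>0$, where $A$ is a diagonalisable positive linear operator on $\mathfrak{g}$ and each $D_\lambda$ is a morphism of the Lie algebra: $[D_\lambda X,D_\lambda Y]=D_\lambda[X,Y]$. The number $Q:=\mathrm{Tr}\,A$ is the homogeneous dimension of $\mathbb{G}$. Via the exponential map $\mathbb{G}$ is identified with $\mathfrak{g}\cong\mathbb{R}^n$, the dilations act on $\mathbb{G}$, and $dx$ is the Haar measure, which is Lebesgue measure on $\mathbb{R}^n$. For $r>0$ and $y\in\mathbb{G}$, $ry$ denotes the dilated point $D_r(y)$; thus for $x\ne 0$, $\frac{x}{|x|}=D_{1/|x|}(x)$ and $\rho\frac{x}{|x|}=D_{\rho/|x|}(x)$ for $\rho>0$. A homogeneous quasi-norm is a continuous function $|\cdot|:\mathbb{G}\to[0,\infty)$ with $|x^{-1}|=|x|$, $|D_\lambda x|=\lambda|x|$ for $\lambda>0$, and $|x|=0$ if and only if $x=0$ (the identity element). The radial derivative is $\mathcal{R}f(x)=\frac{d}{d|x|}f(x)$, i.e. writing $x=ry$ with $r=|x|$ and $|y|=1$, $\mathcal{R}f(x)=\frac{\partial}{\partial r}f(ry)$. $C_0^\infty(B(0,R))$ denotes smooth functions compactly supported in $B(0,R)$. The quantity $d_{cH}(u;T,R)$ is considered for parameters $T>0$ and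 functions $u$, $f_{T,R}$ for which the defining integral is finite. *)

theory Defs
  imports "HOL-Analysis.Analysis"
begin

text \<open>
  \<open>C_diff k f\<close>: all iterated directional derivatives of \<open>f\<close> up to order \<open>k\<close> exist as Frechet
  derivatives and are continuous. On a finite-dimensional domain this is \<open>C\<^sup>k\<close>.
\<close>

primrec C_diff :: "nat \<Rightarrow> ('a::real_normed_vector \<Rightarrow> 'b::real_normed_vector) \<Rightarrow> bool" where
  "C_diff 0 f \<longleftrightarrow> continuous_on UNIV f"
| "C_diff (Suc k) f \<longleftrightarrow>
     f differentiable_on UNIV \<and> (\<forall>v. C_diff k (\<lambda>x. frechet_derivative f (at x) v))"

definition smooth :: "('a::real_normed_vector \<Rightarrow> 'b::real_normed_vector) \<Rightarrow> bool" where
  "smooth f \<longleftrightarrow> (\<forall>k. C_diff k f)"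

text \<open>Smooth functions on the whole space whose support is a compact subset of \<open>\<Omega>\<close>.\<close>

definition Cinf0 :: "'a::real_normed_vector set \<Rightarrow> ('a \<Rightarrow> real) set" where
  "Cinf0 \<Omega> = {u. smooth u \<and> compact (closure {x. u x \<noteq> 0}) \<and> closure {x. u x \<noteq> 0} \<subseteq> \<Omega>}"

definition diagonalisable :: "('a::real_vector \<Rightarrow> 'a) \<Rightarrow> bool" where
  "diagonalisable A \<longleftrightarrow> linear A \<and>
     (\<exists>B. independent B \<and> span B = UNIV \<and> (\<forall>b\<in>B. \<exists>c. A b = c *\<^sub>R b))"

text \<open>
  Positivity is that of the eigenvalues: the Lie algebra carries no distinguished inner product.
\<close>

definition positive_operator :: "('a::real_vector \<Rightarrow> 'a) \<Rightarrow> bool" where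
  "positive_operator A \<longleftrightarrow> (\<forall>c v. v \<noteq> 0 \<and> A v = c *\<^sub>R v \<longrightarrow> c > 0)"

text \<open>\<open>D\<^sub>r = Exp (A ln r)\<close>, with the exponential series evaluated pointwise; only used for \<open>r > 0\<close>.\<close>

definition dilation :: "('a::real_normed_vector \<Rightarrow> 'a) \<Rightarrow> real \<Rightarrow> 'a \<Rightarrow> 'a" where
  "dilation A r x = (\<Sum>k. (1 / fact k) *\<^sub>R ((\<lambda>y. ln r *\<^sub>R A y) ^^ k) x)"

text \<open>
  The Lie algebra of a Lie group structure on \<open>\<real>\<^sup>n\<close> with neutral element \<open>0\<close> is the tangent space
  \<open>\<real>\<^sup>n\<close> at \<open>0\<close>. Its bracket is the value at \<open>0\<close> of the commutator of the left invariant vector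
  fields, where \<open>[V, W] = DW V - DV W\<close> for vector fields \<open>V, W\<close> on \<open>\<real>\<^sup>n\<close>.
\<close>

definition left_inv_field ::
  "('a::real_normed_vector \<Rightarrow> 'a \<Rightarrow> 'a) \<Rightarrow> 'a \<Rightarrow> 'a \<Rightarrow> 'a" where
  "left_inv_field gmul X x = frechet_derivative (\<lambda>y. gmul x y) (at 0) X"

definition lie_bracket ::
  "('a::real_normed_vector \<Rightarrow> 'a \<Rightarrow> 'a) \<Rightarrow> 'a \<Rightarrow> 'a \<Rightarrow> 'a" where
  "lie_bracket gmul X Y =
     frechet_derivative (left_inv_field gmul Y) (at 0) X -
     frechet_derivative (left_inv_field gmul X) (at 0) Y"

text \<open>
  A homogeneous group in exponential coordinates. The underlying manifold is \<open>\<real>\<^sup>n\<close>, hence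
  connected and simply connected. Assumption \<open>exp_coords\<close> says that \<open>t \<mapsto> t X\<close> is the
  one-parameter subgroup with tangent vector \<open>X\<close>, i.e. that the exponential map from the
  Lie algebra \<open>\<real>\<^sup>n\<close> to the group \<open>\<real>\<^sup>n\<close> is the identity.
\<close>

locale homogeneous_group = Groups.group gmul 0 ginv
  for gmul :: "real ^ 'n \<Rightarrow> real ^ 'n \<Rightarrow> real ^ 'n" and ginv :: "real ^ 'n \<Rightarrow> real ^ 'n" +
  fixes A :: "real ^ 'n \<Rightarrow> real ^ 'n"
  assumes smooth_mult: "smooth (\<lambda>p. gmul (fst p) (snd p))"
    and smooth_inv: "smooth ginv"
    and exp_coords: "gmul (s *\<^sub>R X) (t *\<^sub>R X) = (s + t) *\<^sub>R X"
    and diagonalisable_A: "diagonalisable A"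
    and positive_A: "positive_operator A"
    and dilation_morphism: "r > 0 \<Longrightarrow>
      lie_bracket gmul (dilation A r X) (dilation A r Y) = dilation A r (lie_bracket gmul X Y)"

definition homogeneous_dimension :: "(real ^ 'n \<Rightarrow> real ^ 'n) \<Rightarrow> real" where
  "homogeneous_dimension A = trace (matrix A)"

definition homogeneous_quasi_norm ::
  "(real ^ 'n \<Rightarrow> real ^ 'n) \<Rightarrow> (real ^ 'n \<Rightarrow> real ^ 'n) \<Rightarrow> (real ^ 'n \<Rightarrow> real) \<Rightarrow> bool" where
  "homogeneous_quasi_norm ginv A nrm \<longleftrightarrow>
     continuous_on UNIV nrm \<and> (\<forall>x. nrm x \<ge> 0) \<and>
     (\<forall>x. nrm (ginv x) = nrm x) \<and>
     (\<forall>r>0. \<forall>x. nrm (dilation A r x) = r * nrm x) \<and>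
     (\<forall>x. nrm x = 0 \<longleftrightarrow> x = 0)"

definition qball :: "(real ^ 'n \<Rightarrow> real) \<Rightarrow> real \<Rightarrow> (real ^ 'n) set" where
  "qball nrm R = {x. nrm x < R}"

text \<open>
  With \<open>r = |x|\<close> and \<open>y = x / |x| = D\<^bsub>1/r\<^esub> x\<close> this is the derivative of \<open>\<rho> \<mapsto> u (D\<^sub>\<rho> y)\<close> at
  \<open>\<rho> = r\<close>. The value at \<open>x = 0\<close> is irrelevant (a null set).
\<close>

definition radial_deriv ::
  "(real ^ 'n \<Rightarrow> real ^ 'n) \<Rightarrow> (real ^ 'n \<Rightarrow> real) \<Rightarrow> (real ^ 'n \<Rightarrow> real) \<Rightarrow> real ^ 'n \<Rightarrow> real" where
  "radial_deriv A nrm u x = deriv (\<lambda>\<rho>. u (dilation A \<rho> (dilation A (1 / nrm x) x))) (nrm x)"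

definition f_TR ::
  "(real ^ 'n \<Rightarrow> real ^ 'n) \<Rightarrow> (real ^ 'n \<Rightarrow> real) \<Rightarrow> (real ^ 'n \<Rightarrow> real) \<Rightarrow> real \<Rightarrow> real \<Rightarrow>
   real ^ 'n \<Rightarrow> real" where
  "f_TR A nrm u T R x =
     (let Q = homogeneous_dimension A in
       T powr ((Q - 1) / Q) *
       u (dilation A (R * exp (- 1 / T)) (dilation A (1 / nrm x) x)) *
       ln (R / nrm x) powr ((Q - 1) / Q))"

text \<open>Real powers of extended nonnegative reals, for exponents \<open>p > 0\<close>.\<close>

definition epowr :: "ennreal \<Rightarrow> real \<Rightarrow> ennreal" where
  "epowr x p = (if x = \<infinity> then \<infinity> else ennreal (enn2real x powr p))"

text \<open>
  Taken with values in \<open>[0, \<infinity>]\<close>, so that neither a divergent integral nor an unbounded supremum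
  over \<open>T\<close> is assigned a finite default value.
\<close>

definition d_cH ::
  "(real ^ 'n \<Rightarrow> real ^ 'n) \<Rightarrow> (real ^ 'n \<Rightarrow> real) \<Rightarrow> (real ^ 'n \<Rightarrow> real) \<Rightarrow> real \<Rightarrow> real \<Rightarrow>
   ennreal" where
  "d_cH A nrm u T R =
     (let Q = homogeneous_dimension A in
       epowr
         (\<integral>\<^sup>+x\<in>qball nrm R.
            ennreal (\<bar>u x - f_TR A nrm u T R x\<bar> powr Q /
              (nrm x powr Q * \<bar>ln (R / nrm x)\<bar> powr Q * \<bar>ln (T * ln (R / nrm x))\<bar> powr Q))
          \<partial>lborel)
         (1 / Q))"

end

theory Submission
  imports Defs
begin

text \<open>
  Along a ray \<open>s \<mapsto> D\<^bsub>R exp (-s)\<^esub> z\<close> with \<open>|z| = 1\<close> put \<open>g s = u (D\<^bsub>R exp (-s)\<^esub> z)\<close>. The variable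
  \<open>s = log (R / |x|)\<close> turns both sides of the inequality into integrals over \<open>(0, \<infinity>)\<close> with respect
  to \<open>ds\<close>: since \<open>g' s = - |x| (\<R> u) x\<close> and the Haar measure is \<open>|x|\<^sup>Q ds\<close> along the ray, the radial
  energy becomes \<open>\<integral> |g'|\<^sup>Q\<close>, the logarithmic Hardy term becomes the classical Hardy term
  \<open>\<integral> |g|\<^sup>Q / s\<^sup>Q\<close>, and the extremal \<open>f\<^bsub>T,R\<^esub>\<close> becomes the multiple of the virtual minimiser
  \<open>s\<^sup>\<alpha>\<close>, \<open>\<alpha> = (Q - 1) / Q\<close>, that agrees with \<open>g\<close> at \<open>s = 1 / T\<close>. So the theorem is a one-dimensional
  Hardy inequality with a remainder (\<open>hardy_half_line\<close>), with a constant that depends only on \<open>Q\<close>,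
  integrated over all rays.

  The one-dimensional inequality is pointwise up to a derivative. Write \<open>g = s\<^sup>\<alpha> \<phi>\<close> and \<open>v = s \<phi>'\<close>;
  then \<open>s |g'|\<^sup>Q = |\<alpha> \<phi> + v|\<^sup>Q\<close>. Uniform convexity of \<open>|\<cdot>|\<^sup>Q\<close> for \<open>Q \<ge> 2\<close> gives the Hardy term
  \<open>|\<alpha> \<phi>|\<^sup>Q\<close>, the exact derivative of \<open>|\<alpha> \<phi>|\<^sup>Q / \<alpha>\<close>, and the gain \<open>c |v|\<^sup>Q\<close>. A second Hardy
  inequality, now in the variable \<open>log s\<close> and centred at \<open>1 / T\<close>, converts the gain into
  \<open>|q|\<^sup>Q\<close> for the quotient \<open>q = (\<phi> s - \<phi> (1 / T)) / log (T s)\<close>, again up to an exact derivative.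
  This is \<open>hardy_pointwise\<close>. The boundary terms can be dropped: near \<open>0\<close>,
  where \<open>g\<close> vanishes, the primitive is nonpositive, and beyond \<open>1 / T\<close> it is nonnegative.

  A shell replaces the measure on the unit sphere of the quasi-norm in the integration over rays. Every
  orbit \<open>t \<mapsto> D\<^bsub>exp t\<^esub> x\<close> with \<open>x \<noteq> 0\<close> spends exactly unit time in the shell \<open>1 \<le> |y| < e\<close>; with Tonelli's theorem
  and the scaling of Lebesgue measure under dilations, an integral over the space is an integral over
  orbits followed by one over the shell (\<open>nn_integral_orbits\<close>).

  All inequalities are between integrals with values in \<open>[0, \<infinity>]\<close>. Hence the single finiteness to be
  shown is that of the radial energy; it holds because every eigenvalue of \<open>A\<close> is positive, so that
  \<open>g' s\<close> decays exponentially, and the other integrals are then finite by the inequality itself.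
\<close>

section \<open>Convexity of real powers of the absolute value\<close>

text \<open>
  The odd power function: \<open>p\<close> times the odd power of order \<open>p - 1\<close> is the derivative of \<open>\<bar>x\<bar> powr p\<close>.
\<close>
definition spow :: "real \<Rightarrow> real \<Rightarrow> real" where
  "spow r x = sgn x * \<bar>x\<bar> powr r"

text \<open>
  Young's inequality with exponents \<open>p\<close> and \<open>p / (p - 1)\<close>, in a form without division
  that remains true for \<open>p = 1\<close>.
\<close>
lemma young_powr:
  fixes p m x :: real
  assumes "p \<ge> 1" "m \<ge> 0" "x \<ge> 0"
  shows "p * m powr (p - 1) * x \<le> (p - 1) * m powr p + x powr p"
proof (cases "p = 1")
  case True
  then show ?thesis using assms by (cases "m = 0") auto
next
  case False
  then have p: "p > 1" using assms by simp
  define q where "q = p / (p - 1)"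
  have q: "q > 1" "1/p + 1/q = 1" "p / q = p - 1"
    using p by (auto simp: q_def field_simps)
  have "x * (m powr (p-1)) \<le> x powr p / p + (m powr (p-1)) powr q / q"
    using p q assms by (intro Youngs_inequality) auto
  also have "(m powr (p-1)) powr q = m powr p"
    using p by (simp add: powr_powr q_def)
  finally have "p * (x * m powr (p-1)) \<le> p * (x powr p / p + m powr p / q)"
    using p by (intro mult_left_mono) auto
  also have "\<dots> = x powr p + (p / q) * m powr p"
    using p by (simp add: field_simps)
  finally show ?thesis using q by (simp add: algebra_simps)
qed

lemma spow_times_self: "spow (p - 1) x * x = \<bar>x\<bar> powr p"
  using powr_mult_base[of "\<bar>x\<bar>" "p-1"] by (auto simp: spow_def sgn_if mult.commute)

text \<open>
  The convex function \<open>\<bar>c\<bar> powr p\<close> lies above its tangent at \<open>a\<close>; by homogeneity this is Young's inequality.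
\<close>
lemma abs_powr_tangent:
  fixes p a c :: real
  assumes "p \<ge> 1"
  shows "\<bar>a\<bar> powr p + p * spow (p - 1) a * (c - a) \<le> \<bar>c\<bar> powr p"
proof -
  have e: "p * spow (p - 1) a * a = p * \<bar>a\<bar> powr p"
    by (simp add: spow_times_self mult.assoc)
  have "spow (p-1) a * c \<le> \<bar>a\<bar> powr (p-1) * \<bar>c\<bar>"
    using abs_ge_self[of "spow (p-1) a * c"]
    by (auto simp: spow_def abs_mult sgn_if split: if_splits)
  then have "p * spow (p-1) a * c \<le> p * \<bar>a\<bar> powr (p-1) * \<bar>c\<bar>"
    using assms by (simp add: mult.assoc mult_left_mono)
  also have "\<dots> \<le> (p - 1) * \<bar>a\<bar> powr p + \<bar>c\<bar> powr p"
    by (rule young_powr) (use assms in auto)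
  finally have "p * spow (p-1) a * c \<le> (p - 1) * \<bar>a\<bar> powr p + \<bar>c\<bar> powr p" .
  then show ?thesis
    using e unfolding left_diff_distrib right_diff_distrib by linarith
qed

lemma powr_superadditive:
  fixes r x y :: real
  assumes "r \<ge> 1" "x \<ge> 0" "y \<ge> 0"
  shows "x powr r + y powr r \<le> (x + y) powr r"
proof -
  have "x powr r = x * x powr (r-1)" "y powr r = y * y powr (r-1)"
       "(x+y) powr r = (x+y) * (x+y) powr (r-1)"
    using assms powr_mult_base[of _ "r-1"] by auto
  moreover have "x * x powr (r-1) \<le> x * (x+y) powr (r-1)" "y * y powr (r-1) \<le> y * (x+y) powr (r-1)"
    using assms by (auto intro!: mult_left_mono powr_mono2)
  ultimately show ?thesis by (simp add: distrib_right)
qed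

lemma powr_midpoint:
  fixes r x y :: real
  assumes "r \<ge> 1" "x \<ge> 0" "y \<ge> 0"
  shows "2 * ((x + y) / 2) powr r \<le> x powr r + y powr r"
  using abs_powr_tangent[of r "(x+y)/2" x] abs_powr_tangent[of r "(x+y)/2" y] assms
  by (simp add: algebra_simps add_divide_distrib diff_divide_distrib)

text \<open>
  Clarkson's inequality on the line. With \<open>\<bar>z\<bar> powr p = (z\<^sup>2) powr (p / 2)\<close> it combines superadditivity
  and midpoint convexity of the power \<open>p / 2 \<ge> 1\<close> through the parallelogram law.
\<close>
lemma clarkson_powr:
  fixes p x y :: real
  assumes "p \<ge> 2"
  shows "2 * \<bar>(x + y) / 2\<bar> powr p + 2 * \<bar>(x - y) / 2\<bar> powr p \<le> \<bar>x\<bar> powr p + \<bar>y\<bar> powr p"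
proof -
  have sq: "\<bar>z\<bar> powr p = (z\<^sup>2) powr (p/2)" for z :: real
    using powr_powr[of "\<bar>z\<bar>" 2 "p/2"] by (cases "z = 0") auto
  have e: "((x+y)/2)\<^sup>2 + ((x-y)/2)\<^sup>2 = (x\<^sup>2 + y\<^sup>2) / 2"
    by (simp add: power2_eq_square field_simps)
  have "((x+y)/2)\<^sup>2 powr (p/2) + ((x-y)/2)\<^sup>2 powr (p/2) \<le> ((x\<^sup>2 + y\<^sup>2) / 2) powr (p/2)"
    using powr_superadditive[of "p/2" "((x+y)/2)\<^sup>2" "((x-y)/2)\<^sup>2"] assms unfolding e by simp
  then show ?thesis
    using powr_midpoint[of "p/2" "x\<^sup>2" "y\<^sup>2"] assms
    unfolding sq by simp
qed

text \<open>
  Clarkson's inequality at \<open>a\<close> and \<open>a + b\<close>, with the tangent inequality used at their midpoint, improves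
  the tangent inequality by a fixed multiple of \<open>\<bar>b\<bar> powr p\<close>.
\<close>
lemma abs_powr_uniform_convexity:
  fixes p a b :: real
  assumes "p \<ge> 2"
  shows "\<bar>a\<bar> powr p + p * spow (p - 1) a * b + 2 powr (1 - p) * \<bar>b\<bar> powr p \<le> \<bar>a + b\<bar> powr p"
proof -
  have "\<bar>a + b/2\<bar> powr p \<ge> \<bar>a\<bar> powr p + p * spow (p - 1) a * (b/2)"
    using abs_powr_tangent[of p a "a + b/2"] assms by simp
  moreover have "2 * \<bar>b/2\<bar> powr p = 2 powr (1-p) * \<bar>b\<bar> powr p"
    by (simp add: powr_divide powr_diff)
  moreover have "2 * \<bar>a + b/2\<bar> powr p + 2 * \<bar>b/2\<bar> powr p \<le> \<bar>a + b\<bar> powr p + \<bar>a\<bar> powr p"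
    using clarkson_powr[OF assms, of "a+b" a] by (simp add: add_divide_distrib)
  ultimately show ?thesis by simp
qed

lemma has_real_derivative_abs_powr:
  fixes p x :: real
  assumes "p > 1"
  shows "((\<lambda>x. \<bar>x\<bar> powr p) has_real_derivative p * spow (p - 1) x) (at x)"
proof -
  consider "x > 0" | "x < 0" | "x = 0" by linarith
  then show ?thesis
  proof cases
    case 1
    have "((\<lambda>x. x powr p) has_real_derivative p * x powr (p - 1)) (at x)"
      using 1 by (auto intro!: derivative_eq_intros)
    then have "((\<lambda>x. \<bar>x\<bar> powr p) has_real_derivative p * x powr (p - 1)) (at x)"
      by (rule has_field_derivative_transform_within_open[where S="{0<..}"]) (use 1 in auto)
    then show ?thesis using 1 by (simp add: spow_def)
  next
    case 2
    have "((\<lambda>x. (-x) powr p) has_real_derivative - (p * (-x) powr (p - 1))) (at x)"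
      using 2 by (auto intro!: derivative_eq_intros)
    then have "((\<lambda>x. \<bar>x\<bar> powr p) has_real_derivative - (p * (-x) powr (p - 1))) (at x)"
      by (rule has_field_derivative_transform_within_open[where S="{..<0}"]) (use 2 in auto)
    then show ?thesis using 2 by (simp add: spow_def)
  next
    case 3
    \<comment> \<open>At the origin the difference quotient is the odd power of order \<open>p - 1 > 0\<close>, which tends to \<open>0\<close>.\<close>
    have "((\<lambda>h. \<bar>h\<bar> powr (p-1)) \<longlongrightarrow> \<bar>0\<bar> powr (p-1)) (at (0::real))"
      by (rule tendsto_powr2) (use assms in \<open>auto intro!: tendsto_eq_intros\<close>)
    then have lim: "((\<lambda>h. \<bar>h\<bar> powr (p-1)) \<longlongrightarrow> 0) (at (0::real))"
      by simp
    have "\<forall>\<^sub>F h in at (0::real). norm (sgn h * \<bar>h\<bar> powr (p-1)) \<le> \<bar>h\<bar> powr (p-1)"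
      by (intro always_eventually allI) (simp add: abs_mult sgn_if)
    then have "((\<lambda>h. sgn h * \<bar>h\<bar> powr (p-1)) \<longlongrightarrow> 0) (at (0::real))"
      by (rule Lim_null_comparison[OF _ lim])
    moreover have "\<bar>h\<bar> powr p / h = sgn h * \<bar>h\<bar> powr (p-1)" for h :: real
      using powr_mult_base[of "\<bar>h\<bar>" "p-1", symmetric] by (cases "h = 0") (simp_all add: sgn_if abs_if)
    ultimately show ?thesis
      using 3 assms by (simp add: DERIV_def spow_def)
  qed
qed

text \<open>
  The algebraic core of the Hardy inequality with remainder. In the application \<open>s\<close> is the variable of
  integration, \<open>\<phi>\<close> is the quotient of \<open>g\<close> by the virtual minimiser, \<open>v = s \<phi>'\<close>, and \<open>q\<close> is the difference
  quotient of \<open>\<phi>\<close> with respect to \<open>log s\<close>. The last summand on the left, divided by \<open>s\<close>, is then an exact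
  derivative, which is why \<open>p * spow (p - 1) q * v\<close> and \<open>(p - 1) * \<bar>q\<bar> powr p\<close> occur in this
  combination. The gain \<open>c * \<bar>v\<bar> powr p\<close> from uniform convexity absorbs the term with \<open>q\<close> and \<open>v\<close>.
\<close>
lemma hardy_pointwise:
  fixes p \<alpha> \<phi> q v c :: real
  assumes p: "p \<ge> 2" and \<alpha>: "\<alpha> \<ge> 0"
  defines "c \<equiv> 2 powr (1 - p)"
  shows "\<bar>\<alpha> * \<phi>\<bar> powr p + c\<^sup>2 * (p - 1) / 2 * \<bar>q\<bar> powr p
     + (p * spow (p - 1) (\<alpha> * \<phi>) * v + c\<^sup>2 * (p * spow (p - 1) q * v - (p - 1) * \<bar>q\<bar> powr p))
     \<le> \<bar>\<alpha> * \<phi> + v\<bar> powr p"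
proof -
  \<comment> \<open>Weight for Young's inequality: \<open>\<theta> powr p = 1 / 2\<close> leaves half of the term with \<open>q\<close>, and the
    price \<open>1 / c\<close> in front of \<open>\<bar>v\<bar> powr p\<close> fits the factor \<open>c\<^sup>2\<close>.\<close>
  define \<theta> :: real where "\<theta> = 2 powr (- 1 / p)"
  have \<theta>: "\<theta> > 0" "\<theta> powr p = 1 / 2"
    using p powr_powr[of 2 "- 1 / p" p] powr_minus_divide[of 2 1] by (simp_all add: \<theta>_def)
  have "(\<theta> powr (p - 1)) powr p = (\<theta> powr p) powr (p - 1)"
    by (simp add: powr_powr mult.commute)
  also have "\<dots> = c"
    unfolding \<theta> c_def using powr_minus_divide[of 2 "p-1"] by (simp add: powr_divide)
  finally have \<theta>2: "(1 / \<theta> powr (p - 1)) powr p = 1 / c"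
    by (simp add: powr_divide)
  have "p * (\<theta> * \<bar>q\<bar>) powr (p - 1) * (\<bar>v\<bar> / \<theta> powr (p - 1))
      \<le> (p - 1) * (\<theta> * \<bar>q\<bar>) powr p + (\<bar>v\<bar> / \<theta> powr (p - 1)) powr p"
    using p \<theta> by (intro young_powr) auto
  also have "(\<bar>v\<bar> / \<theta> powr (p - 1)) powr p = \<bar>v\<bar> powr p / c"
    using \<theta>2 powr_mult[of "\<bar>v\<bar>" "1 / \<theta> powr (p - 1)" p] by simp
  also have "p * (\<theta> * \<bar>q\<bar>) powr (p - 1) * (\<bar>v\<bar> / \<theta> powr (p - 1)) = p * (\<bar>q\<bar> powr (p-1) * \<bar>v\<bar>)"
    using \<theta> by (simp add: powr_mult)
  also have "(p - 1) * (\<theta> * \<bar>q\<bar>) powr p = (p - 1) / 2 * \<bar>q\<bar> powr p"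
    using \<theta> by (simp add: powr_mult)
  finally have "p * (\<bar>q\<bar> powr (p-1) * \<bar>v\<bar>) \<le> (p - 1) / 2 * \<bar>q\<bar> powr p + \<bar>v\<bar> powr p / c" .
  moreover have "spow (p-1) q * v \<le> \<bar>q\<bar> powr (p-1) * \<bar>v\<bar>"
    using abs_ge_self[of "spow (p-1) q * v"]
    by (auto simp: spow_def abs_mult sgn_if split: if_splits)
  then have "p * (spow (p-1) q * v) \<le> p * (\<bar>q\<bar> powr (p-1) * \<bar>v\<bar>)"
    using p by (intro mult_left_mono) auto
  ultimately have "p * (spow (p-1) q * v) \<le> (p - 1) / 2 * \<bar>q\<bar> powr p + \<bar>v\<bar> powr p / c"
    by linarith
  then have "c\<^sup>2 * (p * (spow (p-1) q * v)) \<le> c\<^sup>2 * ((p - 1) / 2 * \<bar>q\<bar> powr p + \<bar>v\<bar> powr p / c)"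
    by (intro mult_left_mono) auto
  also have "\<dots> = c\<^sup>2 * (p - 1) / 2 * \<bar>q\<bar> powr p + c * \<bar>v\<bar> powr p"
    by (simp add: c_def power2_eq_square algebra_simps)
  finally have "c\<^sup>2 * (p * spow (p-1) q * v) \<le> c\<^sup>2 * (p - 1) / 2 * \<bar>q\<bar> powr p + c * \<bar>v\<bar> powr p"
    by (simp only: mult.assoc)
  moreover have "c\<^sup>2 * ((p - 1) * \<bar>q\<bar> powr p) = 2 * (c\<^sup>2 * (p - 1) / 2 * \<bar>q\<bar> powr p)"
    by simp
  ultimately show ?thesis
    using abs_powr_uniform_convexity[OF p, of "\<alpha> * \<phi>" v]
    unfolding c_def[symmetric] right_diff_distrib[of "c\<^sup>2"] by linarith
qed

section \<open>Hardy inequality with remainder on the half-line\<close>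

text \<open>
  The constant of the remainder in \<open>hardy_pointwise\<close>: half of \<open>p - 1\<close>, times the square of the modulus of uniform convexity.
\<close>
definition remainder_const :: "real \<Rightarrow> real" where
  "remainder_const p = (2 powr (1 - p))\<^sup>2 * (p - 1) / 2"

definition hardy_integrand :: "real \<Rightarrow> real \<Rightarrow> (real \<Rightarrow> real) \<Rightarrow> real \<Rightarrow> real" where
  "hardy_integrand p T g s =
     ((p - 1) / p) powr p * (\<bar>g s\<bar> powr p / s powr p) +
     remainder_const p * (\<bar>g s - T powr ((p - 1) / p) * g (1 / T) * s powr ((p - 1) / p)\<bar> powr p /
       (s powr p * \<bar>ln (T * s)\<bar> powr p))"

lemma hardy_integrand_nonneg: "p \<ge> 1 \<Longrightarrow> hardy_integrand p T g s \<ge> 0"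
  by (auto simp: hardy_integrand_def remainder_const_def)

text \<open>
  The pointwise inequality integrated over a compact interval around \<open>1 / T\<close>. The terms \<open>p * spow \<dots>\<close>
  of \<open>hardy_pointwise\<close> are the derivative of \<open>H\<close> below. Since \<open>\<phi>\<close> vanishes at \<open>a\<close>, and \<open>log (T s)\<close> is negative at
  \<open>a\<close> and positive at \<open>b\<close>, one has \<open>H a \<le> 0 \<le> H b\<close>, so the boundary terms can be dropped.
\<close>
lemma hardy_interval:
  fixes g g' :: "real \<Rightarrow> real" and p T a b :: real
  assumes p: "p \<ge> 2" and T: "T > 0" and ab: "0 < a" "a < 1 / T" "1 / T < b"
    and deriv: "\<And>s. (g has_real_derivative g' s) (at s)"
    and cont: "continuous_on UNIV g'"
    and zero: "g a = 0"
  shows "(\<integral>\<^sup>+s\<in>{a..b}. ennreal (hardy_integrand p T g s) \<partial>lborel) \<le> (\<integral>\<^sup>+s\<in>{a..b}. ennreal (\<bar>g' s\<bar> powr p) \<partial>lborel)"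
proof -
  define \<alpha> where "\<alpha> = (p - 1) / p"
  have \<alpha>: "\<alpha> > 0" "\<alpha> * p = p - 1" "(1 - \<alpha>) * p = 1"
    using p by (auto simp: \<alpha>_def field_simps)
  define c :: real where "c = 2 powr (1 - p)"
  define \<phi> where "\<phi> s = g s * s powr (- \<alpha>)" for s
  define v where "v s = s powr (1 - \<alpha>) * g' s - \<alpha> * \<phi> s" for s
  define s0 where "s0 = 1 / T"
  have s0: "s0 > 0" "a < s0" "s0 < b" using T ab by (auto simp: s0_def)
  define L where "L s = ln s - ln s0" for s
  have L: "ln (T * s) = L s" if "s > 0" for s
    using that T by (simp add: L_def s0_def ln_div ln_mult)
  have L0: "L s = 0 \<longleftrightarrow> s = s0" if "s > 0" for s
    using that s0 by (simp add: L_def)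
  \<comment> \<open>At \<open>s = s0\<close> the quotient has the default value \<open>0\<close>. This is harmless: the pointwise inequality
    holds for every real value of \<open>q\<close>, and \<open>H\<close> contains \<open>q\<close> only with the factor \<open>L\<close>, which
    vanishes at \<open>s0\<close>.\<close>
  define q where "q s = (\<phi> s - \<phi> s0) / L s" for s
  define H where "H s = \<bar>\<alpha> * \<phi> s\<bar> powr p / \<alpha> + c\<^sup>2 * (\<bar>q s\<bar> powr p * L s)" for s
  define H' where "H' s = (p * spow (p - 1) (\<alpha> * \<phi> s) * v s
     + c\<^sup>2 * (p * spow (p - 1) (q s) * v s - (p - 1) * \<bar>q s\<bar> powr p)) / s" for s
  have D\<phi>: "(\<phi> has_real_derivative v s / s) (at s)" if "s > 0" for s
  proof -
    have "(\<phi> has_real_derivative g' s * s powr (- \<alpha>) + g s * (- \<alpha> * s powr (- \<alpha> - 1))) (at s)"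
      unfolding \<phi>_def[abs_def] using that deriv[of s]
      by (auto intro!: derivative_eq_intros)
    also have "g' s * s powr (- \<alpha>) + g s * (- \<alpha> * s powr (- \<alpha> - 1)) = v s / s"
      using that by (simp add: v_def \<phi>_def powr_diff powr_minus field_simps)
    finally show ?thesis .
  qed
  have DL: "(L has_real_derivative 1 / s) (at s)" if "s > 0" for s
    unfolding L_def[abs_def] using that by (auto intro!: derivative_eq_intros)
  have D1: "((\<lambda>s. \<bar>\<alpha> * \<phi> s\<bar> powr p / \<alpha>) has_real_derivative p * spow (p - 1) (\<alpha> * \<phi> s) * v s / s) (at s)"
    if "s > 0" for s
  proof -
    have "((\<lambda>s. \<alpha> * \<phi> s) has_real_derivative \<alpha> * (v s / s)) (at s)"
      using D\<phi>[OF that] by (rule DERIV_cmult)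
    from DERIV_chain2[OF has_real_derivative_abs_powr this, of p]
    have "((\<lambda>s. \<bar>\<alpha> * \<phi> s\<bar> powr p) has_real_derivative p * spow (p - 1) (\<alpha> * \<phi> s) * (\<alpha> * (v s / s))) (at s)"
      using p by simp
    from DERIV_cdivide[OF this, of \<alpha>] show ?thesis
      using \<alpha> by (simp add: field_simps)
  qed
  have D2: "((\<lambda>s. \<bar>q s\<bar> powr p * L s) has_real_derivative
      (p * spow (p - 1) (q s) * v s - (p - 1) * \<bar>q s\<bar> powr p) / s) (at s)" if "s > 0" "s \<noteq> s0" for s
  proof -
    have nz: "L s \<noteq> 0" using L0 that by auto
    have "((\<lambda>s. \<phi> s - \<phi> s0) has_real_derivative v s / s) (at s)"
      using DERIV_diff[OF D\<phi>[OF that(1)] DERIV_const[of "\<phi> s0"]] by simp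
    from DERIV_divide[OF this DL[OF that(1)] nz]
    have "(q has_real_derivative ((v s / s) * L s - (\<phi> s - \<phi> s0) * (1 / s)) / (L s * L s)) (at s)"
      by (simp add: q_def[abs_def])
    also have "((v s / s) * L s - (\<phi> s - \<phi> s0) * (1 / s)) / (L s * L s) = (v s - q s) / (s * L s)"
      using nz that by (simp add: q_def field_simps)
    finally have Dq: "(q has_real_derivative (v s - q s) / (s * L s)) (at s)" .
    have "((\<lambda>s. \<bar>q s\<bar> powr p * L s) has_real_derivative
        (p * spow (p - 1) (q s) * ((v s - q s) / (s * L s))) * L s + (1 / s) * \<bar>q s\<bar> powr p) (at s)"
      using p by (intro DERIV_mult DL DERIV_chain2[OF has_real_derivative_abs_powr Dq] that) auto
    also have "(p * spow (p - 1) (q s) * ((v s - q s) / (s * L s))) * L s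
        = (p * spow (p - 1) (q s) * v s - p * (spow (p - 1) (q s) * q s)) / s"
      using nz that by (simp add: field_simps)
    also have "spow (p - 1) (q s) * q s = \<bar>q s\<bar> powr p"
      by (rule spow_times_self)
    also have "(p * spow (p - 1) (q s) * v s - p * \<bar>q s\<bar> powr p) / s + (1 / s) * \<bar>q s\<bar> powr p
       = (p * spow (p - 1) (q s) * v s - (p - 1) * \<bar>q s\<bar> powr p) / s"
      using that by (simp add: field_simps)
    finally show ?thesis .
  qed
  have DH: "(H has_real_derivative H' s) (at s)" if "s > 0" "s \<noteq> s0" for s
    using DERIV_add[OF D1[OF that(1)] DERIV_cmult[OF D2[OF that], of "c\<^sup>2"]]
    by (simp add: H_def[abs_def] H'_def add_divide_distrib)
  \<comment> \<open>\<open>H\<close> need not be differentiable at \<open>s0\<close>, but it is continuous there: \<open>q\<close> has the limit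
    \<open>s0 \<phi>' s0\<close>, the quotient of two difference quotients. One exceptional point does no harm to
    the fundamental theorem of calculus.\<close>
  have "isCont (\<lambda>s. \<bar>q s\<bar> powr p * L s) s0"
  proof -
    have A: "((\<lambda>s. (\<phi> s - \<phi> s0) / (s - s0)) \<longlongrightarrow> v s0 / s0) (at s0)"
      using D\<phi>[OF s0(1)] by (simp add: has_field_derivative_iff)
    have B: "((\<lambda>s. (L s - L s0) / (s - s0)) \<longlongrightarrow> 1 / s0) (at s0)"
      using DL[OF s0(1)] by (simp add: has_field_derivative_iff)
    have "((\<lambda>s. ((\<phi> s - \<phi> s0) / (s - s0)) / ((L s - L s0) / (s - s0))) \<longlongrightarrow> (v s0 / s0) / (1 / s0)) (at s0)"
      by (rule tendsto_divide[OF A B]) (use s0 in auto)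
    moreover have "\<forall>\<^sub>F s in at s0. ((\<phi> s - \<phi> s0) / (s - s0)) / ((L s - L s0) / (s - s0)) = q s"
      using eventually_neq_at_within[of s0 s0 UNIV]
      by eventually_elim (simp add: q_def L_def)
    ultimately have "(q \<longlongrightarrow> (v s0 / s0) / (1 / s0)) (at s0)"
      by (rule Lim_transform_eventually)
    then have "((\<lambda>s. \<bar>q s\<bar> powr p) \<longlongrightarrow> \<bar>(v s0 / s0) / (1 / s0)\<bar> powr p) (at s0)"
      using p by (intro tendsto_powr2 tendsto_rabs tendsto_const) auto
    moreover have "(L \<longlongrightarrow> L s0) (at s0)"
      using DERIV_isCont[OF DL[OF s0(1)]] by (simp add: isCont_def)
    ultimately have "((\<lambda>s. \<bar>q s\<bar> powr p * L s) \<longlongrightarrow> \<bar>(v s0 / s0) / (1 / s0)\<bar> powr p * L s0) (at s0)"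
      by (rule tendsto_mult)
    then show ?thesis
      by (simp add: isCont_def L_def)
  qed
  from continuous_mult[OF continuous_const this, of "c\<^sup>2"] have "isCont H s0"
    unfolding H_def[abs_def] by (rule continuous_add[OF DERIV_isCont[OF D1[OF s0(1)]]])
  then have contH: "continuous_on {a..b} H"
    using DERIV_isCont[OF DH] ab by (intro continuous_at_imp_continuous_on) (metis atLeastAtMost_iff less_le_trans)
  have intH: "(H' has_integral (H b - H a)) {a..b}"
    using s0 ab DH contH
    by (intro fundamental_theorem_of_calculus_interior_strong[of "{s0}"])
       (auto simp flip: has_real_derivative_iff_has_vector_derivative)
  have "continuous_on {a..b} (\<lambda>s. \<bar>g' s\<bar> powr p)"
    using p by (intro continuous_on_powr' continuous_on_subset[OF cont] continuous_intros) auto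
  then obtain J where J: "((\<lambda>s. \<bar>g' s\<bar> powr p) has_integral J) {a..b}"
    using integrable_continuous_interval by blast
  have le: "hardy_integrand p T g s \<le> \<bar>g' s\<bar> powr p - H' s" if "s \<in> {a..b}" for s
  proof -
    have s: "s > 0" using that ab by auto
    have e1: "((p - 1) / p) powr p * (\<bar>g s\<bar> powr p / s powr p) = \<bar>\<alpha> * \<phi> s\<bar> powr p / s"
    proof -
      have "\<bar>\<alpha> * \<phi> s\<bar> powr p = \<alpha> powr p * (\<bar>g s\<bar> powr p * s powr (- (p - 1)))"
        using \<alpha> by (simp add: \<phi>_def abs_mult powr_mult powr_powr flip: \<alpha>(2))
      also have "s powr (- (p - 1)) = s / s powr p"
        using s by (simp add: powr_diff)
      finally show ?thesis using s by (simp add: \<alpha>_def)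
    qed
    have e2: "\<bar>g s - T powr ((p - 1) / p) * g (1 / T) * s powr ((p - 1) / p)\<bar> powr p /
       (s powr p * \<bar>ln (T * s)\<bar> powr p) = \<bar>q s\<bar> powr p / s"
    proof -
      have "T powr \<alpha> * g (1 / T) = \<phi> s0"
        using T by (simp add: \<phi>_def s0_def powr_minus powr_divide)
      then have "g s - T powr \<alpha> * g (1 / T) * s powr \<alpha> = s powr \<alpha> * (\<phi> s - \<phi> s0)"
        using s by (simp add: \<phi>_def[of s] powr_minus field_simps)
      then have "\<bar>g s - T powr \<alpha> * g (1 / T) * s powr \<alpha>\<bar> powr p = s powr (p - 1) * \<bar>\<phi> s - \<phi> s0\<bar> powr p"
        using \<alpha> by (simp add: abs_mult powr_mult powr_powr)
      then show ?thesis
        using s unfolding L[OF s] \<alpha>_def[symmetric]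
        by (simp add: q_def powr_divide powr_diff)
    qed
    have e3: "\<bar>\<alpha> * \<phi> s + v s\<bar> powr p / s = \<bar>g' s\<bar> powr p"
      using s \<alpha> by (simp add: v_def abs_mult powr_mult powr_powr)
    have "(\<bar>\<alpha> * \<phi> s\<bar> powr p + c\<^sup>2 * (p - 1) / 2 * \<bar>q s\<bar> powr p
        + (p * spow (p - 1) (\<alpha> * \<phi> s) * v s
          + c\<^sup>2 * (p * spow (p - 1) (q s) * v s - (p - 1) * \<bar>q s\<bar> powr p))) / s
        \<le> \<bar>\<alpha> * \<phi> s + v s\<bar> powr p / s"
      using s \<alpha> p unfolding c_def by (intro divide_right_mono hardy_pointwise) auto
    then show ?thesis
      unfolding hardy_integrand_def remainder_const_def e1 e2 e3 H'_def c_def[symmetric]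
      by (simp add: add_divide_distrib)
  qed
  have "(\<integral>\<^sup>+s\<in>{a..b}. ennreal (hardy_integrand p T g s) \<partial>lborel) \<le>
        (\<integral>\<^sup>+s\<in>{a..b}. ennreal (\<bar>g' s\<bar> powr p - H' s) \<partial>lborel)"
    using le by (intro nn_integral_mono) (auto simp: indicator_def intro!: ennreal_leI)
  also have "\<dots> = ennreal (J - (H b - H a))"
  proof (rule nn_integral_has_integral_lebesgue'[OF _ has_integral_diff[OF J intH]])
    show "0 \<le> \<bar>g' s\<bar> powr p - H' s" if "s \<in> {a..b}" for s
      by (rule order_trans[OF hardy_integrand_nonneg le[OF that]]) (use p in simp)
  qed
  also have "\<dots> \<le> ennreal J"
  proof (rule ennreal_leI)
    have "H a \<le> 0"
      using zero s0 ab by (auto simp: H_def \<phi>_def L_def intro!: mult_nonneg_nonpos)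
    moreover have "H b \<ge> 0"
      using s0 ab \<alpha> by (auto simp: H_def L_def)
    ultimately show "J - (H b - H a) \<le> J" by simp
  qed
  also have "ennreal J = (\<integral>\<^sup>+s\<in>{a..b}. ennreal (\<bar>g' s\<bar> powr p) \<partial>lborel)"
    by (rule nn_integral_has_integral_lebesgue'[symmetric, OF _ J]) auto
  finally show ?thesis .
qed

text \<open>
  The intervals \<open>[1/n, n]\<close> exhaust the half-line, and Fatou's lemma passes to the limit. For large \<open>n\<close> the left
  endpoint lies where \<open>g\<close> vanishes and \<open>1 / T\<close> lies inside, so \<open>hardy_interval\<close> applies.
\<close>
lemma hardy_half_line:
  fixes g g' :: "real \<Rightarrow> real" and p T a0 :: real
  assumes p: "p \<ge> 2" and T: "T > 0" and a0: "a0 > 0"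
    and deriv: "\<And>s. (g has_real_derivative g' s) (at s)"
    and cont: "continuous_on UNIV g'"
    and zero: "\<And>s. 0 < s \<Longrightarrow> s \<le> a0 \<Longrightarrow> g s = 0"
  shows "(\<integral>\<^sup>+s\<in>{0<..}. ennreal (hardy_integrand p T g s) \<partial>lborel) \<le> (\<integral>\<^sup>+s\<in>{0<..}. ennreal (\<bar>g' s\<bar> powr p) \<partial>lborel)"
    (is "_ \<le> ?X")
proof -
  define I where "I n = {inverse (real (Suc n))..real (Suc n)}" for n
  have [measurable]: "g \<in> borel_measurable borel"
    using deriv by (intro borel_measurable_continuous_onI continuous_at_imp_continuous_on)
      (auto intro: DERIV_isCont)
  have small: "\<forall>\<^sub>F n in sequentially. inverse (real (Suc n)) < e" if "e > 0" for e
    using order_tendstoD(2)[OF LIMSEQ_inverse_real_of_nat that] .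
  have large: "\<forall>\<^sub>F n in sequentially. x < real (Suc n)" for x :: real
    using filterlim_at_top_dense[THEN iffD1, OF filterlim_real_sequentially, rule_format, of x]
    by eventually_elim simp
  \<comment> \<open>Every point lies in all but finitely many of the intervals, so the truncated integrands converge.\<close>
  have ev: "\<forall>\<^sub>F n in sequentially. s \<in> I n" if "s > 0" for s
    unfolding I_def using eventually_conj[OF small[OF that] large[of s]]
    by eventually_elim auto
  have lim: "liminf (\<lambda>n. ennreal (hardy_integrand p T g s) * indicator (I n) s)
     = ennreal (hardy_integrand p T g s) * indicator {0<..} s" for s
  proof (rule lim_imp_Liminf)
    show "(\<lambda>n. ennreal (hardy_integrand p T g s) * indicator (I n) s)
       \<longlonglongrightarrow> ennreal (hardy_integrand p T g s) * indicator {0<..} s"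
    proof (cases "s > 0")
      case True
      show ?thesis
        by (rule tendsto_eventually, rule eventually_mono[OF ev[OF True]]) (use True in auto)
    next
      case False
      then have "s \<notin> I n" for n
        using order.strict_trans2[of 0 "inverse (real (Suc n))" s] by (auto simp: I_def simp del: of_nat_Suc)
      then show ?thesis using False by simp
    qed
  qed simp
  have "(\<integral>\<^sup>+s\<in>{0<..}. ennreal (hardy_integrand p T g s) \<partial>lborel) =
        (\<integral>\<^sup>+s. liminf (\<lambda>n. ennreal (hardy_integrand p T g s) * indicator (I n) s) \<partial>lborel)"
    by (simp only: lim)
  also have "\<dots> \<le> liminf (\<lambda>n. \<integral>\<^sup>+s. ennreal (hardy_integrand p T g s) * indicator (I n) s \<partial>lborel)"
    by (rule nn_integral_liminf) (unfold hardy_integrand_def I_def, measurable)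
  also have "\<dots> \<le> ?X"
  proof (rule Liminf_le)
    have "\<forall>\<^sub>F n in sequentially. inverse (real (Suc n)) < min a0 (1/T) \<and> 1 / T < real (Suc n)"
      using a0 T by (intro eventually_conj small large) auto
    then show "\<forall>\<^sub>F n in sequentially. (\<integral>\<^sup>+s. ennreal (hardy_integrand p T g s) * indicator (I n) s \<partial>lborel) \<le> ?X"
    proof eventually_elim
      case (elim n)
      have "(\<integral>\<^sup>+s. ennreal (hardy_integrand p T g s) * indicator (I n) s \<partial>lborel) \<le>
         (\<integral>\<^sup>+s. ennreal (\<bar>g' s\<bar> powr p) * indicator (I n) s \<partial>lborel)"
        unfolding I_def using elim by (intro hardy_interval p T deriv cont zero) auto
      also have "\<dots> \<le> ?X"
        by (intro nn_integral_mono mult_left_mono)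
           (auto simp: I_def indicator_def simp del: of_nat_Suc intro: order.strict_trans2[of 0 "inverse (real (Suc n))"])
      finally show ?case .
    qed
  qed simp
  finally show ?thesis .
qed

section \<open>Dilations with a basis of eigenvectors\<close>

lemma nn_integral_lborel_translate:
  fixes f :: "'a::euclidean_space \<Rightarrow> ennreal"
  assumes [measurable]: "f \<in> borel_measurable borel"
  shows "(\<integral>\<^sup>+x. f (x + a) \<partial>lborel) = (\<integral>\<^sup>+x. f x \<partial>lborel)"
proof -
  have "(\<integral>\<^sup>+x. f x \<partial>lborel) = (\<integral>\<^sup>+x. f x \<partial>distr lborel borel ((+) a))"
    by (simp only: lborel_distr_plus)
  then show ?thesis by (simp add: nn_integral_distr add.commute)
qed

lemma nn_integral_lborel_reflect:
  fixes f :: "'a::euclidean_space \<Rightarrow> ennreal"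
  assumes [measurable]: "f \<in> borel_measurable borel"
  shows "(\<integral>\<^sup>+x. f (a - x) \<partial>lborel) = (\<integral>\<^sup>+x. f x \<partial>lborel)"
proof -
  have "(\<integral>\<^sup>+x. f x \<partial>lborel) = (\<integral>\<^sup>+x. f x \<partial>distr lborel borel (\<lambda>x. a - x))"
    using lborel_affine[of "-1" a] by (simp add: density_1)
  then show ?thesis by (simp add: nn_integral_distr)
qed

text \<open>
  Uniqueness of Haar measure for the special case of a linear image of Lebesgue measure: both products
  equal the integral of \<open>f (x + P z) * g (P z)\<close> over all pairs, after translations of \<open>x\<close> and of \<open>z\<close>. With a fixed \<open>g\<close>
  it says that a linear isomorphism multiplies all integrals by the same constant; in a change
  of basis and back this constant cancels.
\<close>
lemma nn_integral_linear_scaling: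
  fixes P P' :: "'a::euclidean_space \<Rightarrow> 'a" and f g :: "'a \<Rightarrow> ennreal"
  assumes P: "linear P" "linear P'" and inv: "\<And>x. P (P' x) = x"
    and [measurable]: "f \<in> borel_measurable borel" "g \<in> borel_measurable borel"
  shows "(\<integral>\<^sup>+x. f x \<partial>lborel) * (\<integral>\<^sup>+z. g (P z) \<partial>lborel) =
         (\<integral>\<^sup>+z. f (P z) \<partial>lborel) * (\<integral>\<^sup>+x. g x \<partial>lborel)"
proof -
  have [measurable]: "P \<in> borel_measurable borel"
    using P by (intro borel_measurable_continuous_onI linear_continuous_on) (simp add: linear_linear)
  have [measurable]: "P' \<in> borel_measurable borel"
    using P by (intro borel_measurable_continuous_onI linear_continuous_on) (simp add: linear_linear)
  have "(\<integral>\<^sup>+x. f x \<partial>lborel) * (\<integral>\<^sup>+z. g (P z) \<partial>lborel) =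
        (\<integral>\<^sup>+z. (\<integral>\<^sup>+x. f x \<partial>lborel) * g (P z) \<partial>lborel)"
    by (simp add: nn_integral_cmult)
  also have "\<dots> = (\<integral>\<^sup>+z. (\<integral>\<^sup>+x. f (x + P z) * g (P z) \<partial>lborel) \<partial>lborel)"
    by (simp add: nn_integral_multc nn_integral_lborel_translate)
  also have "\<dots> = (\<integral>\<^sup>+x. (\<integral>\<^sup>+z. f (x + P z) * g (P z) \<partial>lborel) \<partial>lborel)"
    by (rule lborel_pair.Fubini') measurable
  also have "\<dots> = (\<integral>\<^sup>+x. (\<integral>\<^sup>+z. f (P z) * g (P z - x) \<partial>lborel) \<partial>lborel)"
  proof (rule nn_integral_cong)
    fix x :: 'a
    have "(\<integral>\<^sup>+z. f (P z) * g (P z - x) \<partial>lborel) = (\<integral>\<^sup>+z. f (P (z + P' x)) * g (P (z + P' x) - x) \<partial>lborel)"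
      by (rule nn_integral_lborel_translate[symmetric]) measurable
    then show "(\<integral>\<^sup>+z. f (x + P z) * g (P z) \<partial>lborel) = (\<integral>\<^sup>+z. f (P z) * g (P z - x) \<partial>lborel)"
      by (simp add: linear_add[OF P(1)] inv add.commute)
  qed
  also have "\<dots> = (\<integral>\<^sup>+z. (\<integral>\<^sup>+x. f (P z) * g (P z - x) \<partial>lborel) \<partial>lborel)"
    by (rule lborel_pair.Fubini') measurable
  also have "\<dots> = (\<integral>\<^sup>+z. f (P z) * (\<integral>\<^sup>+x. g x \<partial>lborel) \<partial>lborel)"
    by (simp add: nn_integral_cmult nn_integral_lborel_reflect)
  also have "\<dots> = (\<integral>\<^sup>+z. f (P z) \<partial>lborel) * (\<integral>\<^sup>+x. g x \<partial>lborel)"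
    by (simp add: nn_integral_multc)
  finally show ?thesis .
qed

text \<open>
  The columns of \<open>P\<close> are a basis of eigenvectors with eigenvalues \<open>lam\<close>, and \<open>P' *v x\<close> are the
  coordinates of \<open>x\<close> in that basis. The flow below is \<open>t \<mapsto> Exp (t A)\<close>, the dilation by \<open>exp t\<close>:
  logarithmic time makes the dilations an action of the additive group of reals.
\<close>
locale diagonal_flow =
  fixes P P' :: "real^'n^'n" and lam :: "'n \<Rightarrow> real"
  assumes right_inverse: "P ** P' = mat 1"
    and lam_pos: "\<And>i. lam i > 0"
begin

lemma left_inverse: "P' ** P = mat 1"
  using right_inverse matrix_left_right_inverse by blast

definition flow :: "real \<Rightarrow> real^'n \<Rightarrow> real^'n" where
  "flow t x = P *v (\<chi> i. exp (lam i * t) * (P' *v x) $ i)"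

text \<open>
  The homogeneous dimension, that is, the trace of the operator with eigenvalues \<open>lam\<close>.
\<close>
definition hdim :: real where "hdim = (\<Sum>i\<in>UNIV. lam i)"

lemma coords_flow: "P' *v flow t x = (\<chi> i. exp (lam i * t) * (P' *v x) $ i)"
  by (simp add: flow_def matrix_vector_mul_assoc left_inverse)

lemma flow_flow: "flow s (flow t x) = flow (s + t) x"
  by (simp add: flow_def[of s] coords_flow) (simp add: flow_def distrib_left exp_add mult.assoc)

lemma flow_0: "flow 0 x = x"
  by (simp add: flow_def vec_lambda_eta matrix_vector_mul_assoc right_inverse)

lemma flow_zero: "flow t 0 = 0"
  by (simp add: flow_def zero_vec_def[symmetric])

lemma flow_sum: "flow t x = (\<Sum>i\<in>UNIV. (exp (lam i * t) * (P' *v x) $ i) *\<^sub>R column i P)"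
  by (simp add: flow_def matrix_mult_sum vector_scalar_mult_def scaleR_vec_def)

lemma continuous_flow: "continuous_on UNIV (\<lambda>(t, x). flow t x)"
  unfolding flow_sum case_prod_beta
  by (intro continuous_intros continuous_on_component linear_continuous_on_compose[where g = "(*v) P'"]) auto

lemma continuous_on_flow [continuous_intros]:
  assumes "continuous_on S f" "continuous_on S h"
  shows "continuous_on S (\<lambda>z. flow (f z) (h z))"
  using continuous_on_compose2[OF continuous_flow, of S "\<lambda>z. (f z, h z)"] assms
  by (auto intro!: continuous_intros)

lemma measurable_flow [measurable]:
  assumes [measurable]: "f \<in> borel_measurable M" "h \<in> borel_measurable M"
  shows "(\<lambda>z. flow (f z) (h z)) \<in> borel_measurable M"
  using continuous_flow by (intro borel_measurable_continuous_Pair[OF assms]) (simp add: case_prod_beta)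

lemma nn_integral_coordinate_scaling:
  fixes f :: "real^'n \<Rightarrow> ennreal"
  assumes [measurable]: "f \<in> borel_measurable borel"
  shows "(\<integral>\<^sup>+x. f x \<partial>lborel) = ennreal (exp (hdim * t)) * (\<integral>\<^sup>+x. f (\<chi> i. exp (lam i * t) * x $ i) \<partial>lborel)"
proof -
  define c :: "real^'n \<Rightarrow> real" where "c j = exp (((\<chi> i. lam i) \<bullet> j) * t)" for j
  define T :: "real^'n \<Rightarrow> real^'n" where "T x = 0 + (\<Sum>j\<in>Basis. (c j * (x \<bullet> j)) *\<^sub>R j)" for x
  have B: "(Basis :: (real^'n) set) = (\<lambda>i. axis i 1) ` UNIV" "inj (\<lambda>i::'n. axis i (1::real))"
    by (auto simp: Basis_vec_def inj_on_def axis_eq_axis)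
  have T: "T x = (\<chi> i. exp (lam i * t) * x $ i)" for x
  proof (rule vec_eq_iff[THEN iffD2], rule allI)
    fix i
    have "T x \<bullet> axis i 1 = c (axis i 1) * (x \<bullet> axis i 1)"
      unfolding T_def using B by (simp add: inner_sum_left_Basis)
    then show "T x $ i = (\<chi> i. exp (lam i * t) * x $ i) $ i"
      by (simp add: c_def inner_axis)
  qed
  have "(\<Prod>j\<in>Basis. ennreal \<bar>c j\<bar>) = ennreal (\<Prod>j\<in>Basis. c j)"
    by (simp add: prod_ennreal c_def)
  also have "(\<Prod>j\<in>Basis. c j) = exp (hdim * t)"
    unfolding B c_def using B(2) by (simp add: prod.reindex exp_sum hdim_def sum_distrib_right inner_axis)
  finally have prod: "(\<Prod>j\<in>Basis. ennreal \<bar>c j\<bar>) = ennreal (exp (hdim * t))" .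
  have [measurable]: "T \<in> borel_measurable borel" unfolding T_def[abs_def] by measurable
  have L: "lborel = density (distr lborel borel T) (\<lambda>_. (\<Prod>j\<in>Basis. ennreal \<bar>c j\<bar>))"
    using lborel_affine_euclidean[of c 0] by (simp add: T_def[abs_def] c_def prod_ennreal)
  have "(\<integral>\<^sup>+x. f x \<partial>lborel) = (\<integral>\<^sup>+x. f x \<partial>density (distr lborel borel T) (\<lambda>_. (\<Prod>j\<in>Basis. ennreal \<bar>c j\<bar>)))"
    by (subst L) (rule refl)
  also have "\<dots> = ennreal (exp (hdim * t)) * (\<integral>\<^sup>+x. f (T x) \<partial>lborel)"
    unfolding prod by (simp add: nn_integral_density nn_integral_distr nn_integral_cmult)
  finally show ?thesis by (simp add: T)
qed

text \<open>
  In eigencoordinates the flow is a product of one-dimensional scalings, whose factors multiply to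
  \<open>exp (hdim * t)\<close>. The unknown constant of the change of basis occurs on both sides and cancels; it is finite
  and nonzero because the inverse change of basis supplies its reciprocal.
\<close>
lemma nn_integral_flow:
  fixes f :: "real^'n \<Rightarrow> ennreal"
  assumes [measurable]: "f \<in> borel_measurable borel"
  shows "(\<integral>\<^sup>+x. f x \<partial>lborel) = ennreal (exp (hdim * t)) * (\<integral>\<^sup>+x. f (flow t x) \<partial>lborel)"
proof -
  define g :: "real^'n \<Rightarrow> ennreal" where "g = indicator (box 0 One)"
  have [measurable]: "g \<in> borel_measurable borel" by (simp add: g_def)
  have g1: "(\<integral>\<^sup>+x. g x \<partial>lborel) = 1"
    by (simp add: g_def emeasure_lborel_box inner_sum_left_Basis[of _ "\<lambda>_. 1", simplified])
  define c where "c = (\<integral>\<^sup>+z. g (P *v z) \<partial>lborel)"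
  have lin: "linear ((*v) P)" "linear ((*v) P')" by auto
  have [measurable]: "(*v) P \<in> borel_measurable borel" "(*v) P' \<in> borel_measurable borel"
    by (intro borel_measurable_continuous_onI linear_continuous_on matrix_vector_mul_bounded_linear)+
  have id1: "P *v (P' *v x) = x" "P' *v (P *v x) = x" for x
    by (simp_all add: matrix_vector_mul_assoc right_inverse left_inverse)
  have scale: "(\<integral>\<^sup>+x. h (P *v x) \<partial>lborel) = (\<integral>\<^sup>+x. h x \<partial>lborel) * c"
    if [measurable]: "h \<in> borel_measurable borel" for h
    using nn_integral_linear_scaling[OF lin id1(1) that, of g] by (simp add: g1 c_def)
  have "1 = (\<integral>\<^sup>+x. g (P' *v x) \<partial>lborel) * c"
    using scale[of "\<lambda>x. g (P' *v x)"] by (simp add: id1 g1)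
  then have c: "c \<noteq> 0" "c \<noteq> \<infinity>"
    by (auto simp: ennreal_mult_top split: if_splits)
  have "(\<integral>\<^sup>+x. f x \<partial>lborel) * c = (\<integral>\<^sup>+x. f (P *v x) \<partial>lborel)"
    by (rule scale[symmetric]) measurable
  also have "\<dots> = ennreal (exp (hdim * t)) * (\<integral>\<^sup>+x. f (P *v (\<chi> i. exp (lam i * t) * x $ i)) \<partial>lborel)"
    by (rule nn_integral_coordinate_scaling) measurable
  also have "(\<integral>\<^sup>+x. f (P *v (\<chi> i. exp (lam i * t) * x $ i)) \<partial>lborel) = (\<integral>\<^sup>+x. f (flow t (P *v x)) \<partial>lborel)"
    by (simp add: flow_def id1)
  also have "\<dots> = (\<integral>\<^sup>+x. f (flow t x) \<partial>lborel) * c"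
    by (rule scale) measurable
  finally have "c * (\<integral>\<^sup>+x. f x \<partial>lborel) = c * (ennreal (exp (hdim * t)) * (\<integral>\<^sup>+x. f (flow t x) \<partial>lborel))"
    by (simp add: mult_ac)
  then show ?thesis using c by (simp add: ennreal_mult_cancel_left)
qed

end

text \<open>
  An eigenbasis has as many elements as there are indices, so it can be written as the columns of an invertible matrix.
\<close>
lemma diagonalisable_positive_obtains:
  fixes A :: "real^'n \<Rightarrow> real^'n"
  assumes "linear A" "independent B" "span B = UNIV" "\<And>b. b \<in> B \<Longrightarrow> \<exists>c. A b = c *\<^sub>R b"
    and "\<And>c v. v \<noteq> 0 \<Longrightarrow> A v = c *\<^sub>R v \<Longrightarrow> c > 0"
  obtains P P' :: "real^'n^'n" and lam where "diagonal_flow P P' lam"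
    "\<And>x. A x = P *v (\<chi> i. lam i * (P' *v x) $ i)" "trace (matrix A) = (\<Sum>i\<in>UNIV. lam i)"
proof -
  have fin: "finite B" using assms(2) by (rule independent_imp_finite)
  have "card B = CARD('n)"
    using basis_card_eq_dim[of B "UNIV :: (real^'n) set"] assms by (simp add: dim_UNIV)
  then obtain f :: "'n \<Rightarrow> real^'n" where f: "bij_betw f UNIV B"
    using finite_same_card_bij[OF finite_class.finite_UNIV fin] by metis
  define P :: "real^'n^'n" where "P = (\<chi> i j. f j $ i)"
  have colP: "column j P = f j" for j
    by (simp add: column_def P_def vec_eq_iff)
  have "columns P = B"
    using f by (auto simp: columns_def colP bij_betw_def)
  then have "\<exists>P'. P ** P' = mat 1"
    unfolding matrix_right_invertible_span_columns span_vec_eq using assms by simp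
  then obtain P' where PP': "P ** P' = mat 1" by blast
  have "\<forall>j. \<exists>c. A (f j) = c *\<^sub>R f j"
    using assms(4) f by (auto simp: bij_betw_def)
  then obtain lam where lam: "\<And>j. A (f j) = lam j *\<^sub>R f j" by metis
  have "f j \<noteq> 0" for j
    using f assms(2) dependent_zero by (metis bij_betw_apply UNIV_I)
  then have pos: "lam j > 0" for j using assms(5) lam by blast
  interpret diagonal_flow P P' lam by unfold_locales (use PP' pos in auto)
  have AP: "A (P *v y) = P *v (\<chi> i. lam i * y $ i)" for y
    by (simp add: matrix_mult_sum colP scalar_mult_eq_scaleR linear_sum[OF assms(1)]
        linear_cmul[OF assms(1)] lam mult.commute)
  have Ax: "A x = P *v (\<chi> i. lam i * (P' *v x) $ i)" for x
    using AP[of "P' *v x"] by (simp add: matrix_vector_mul_assoc PP')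
  define D :: "real^'n^'n" where "D = (\<chi> i j. if i = j then lam i else 0)"
  have "D *v y = (\<chi> i. lam i * y $ i)" for y
    by (simp add: D_def matrix_vector_mult_def vec_eq_iff if_distrib[of "\<lambda>z. z * _"] cong: if_cong)
  then have "A x = (P ** (D ** P')) *v x" for x
    by (simp add: Ax flip: matrix_vector_mul_assoc)
  then have "matrix A = P ** (D ** P')"
    using matrix_of_matrix_vector_mul[of "P ** (D ** P')"] by presburger
  then have "trace (matrix A) = trace ((D ** P') ** P)"
    by (simp only: trace_mul_sym[of P])
  also have "\<dots> = trace D"
    by (simp only: matrix_mul_assoc[symmetric] left_inverse matrix_mul_rid)
  also have "\<dots> = (\<Sum>i\<in>UNIV. lam i)"
    by (simp add: trace_def D_def)
  finally show ?thesis using that diagonal_flow_axioms Ax by blast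
qed

section \<open>Integration along the orbits of the dilations\<close>

locale homogeneous_norm = diagonal_flow P P' lam for P P' :: "real^'n^'n" and lam +
  fixes nrm :: "real^'n \<Rightarrow> real"
  assumes cont_nrm: "continuous_on UNIV nrm"
    and nrm_nonneg: "nrm x \<ge> 0"
    and nrm_eq_0: "nrm x = 0 \<longleftrightarrow> x = 0"
    and nrm_flow: "nrm (flow t x) = exp t * nrm x"
begin

lemma nrm_pos: "x \<noteq> 0 \<Longrightarrow> nrm x > 0"
  using nrm_nonneg[of x] nrm_eq_0[of x] by linarith

lemma measurable_nrm [measurable]: "nrm \<in> borel_measurable borel"
  using cont_nrm by (rule borel_measurable_continuous_onI)

definition shell :: "(real^'n) set" where "shell = {y. 1 \<le> nrm y \<and> nrm y < exp 1}"

lemma sets_shell [measurable]: "shell \<in> sets borel"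
  unfolding shell_def by measurable

text \<open>
  Polar coordinates without a surface measure. Since \<open>|D\<^bsub>exp (-t)\<^esub> x| = exp (-t) |x|\<close>, the set of times at which an orbit is
  in the shell is a half-open interval of length \<open>1\<close>. Inserting this \<open>1\<close> as an integral over \<open>t\<close>,
  exchanging the integrals and substituting \<open>x = flow t y\<close> gives the formula.
\<close>
lemma nn_integral_orbits:
  assumes [measurable]: "F \<in> borel_measurable borel"
  shows "(\<integral>\<^sup>+x. F x \<partial>lborel) =
    (\<integral>\<^sup>+y\<in>shell. (\<integral>\<^sup>+t. F (flow t y) * ennreal (exp (hdim * t)) \<partial>lborel) \<partial>lborel)"
proof -
  have one: "(\<integral>\<^sup>+t. indicator shell (flow (-t) x) \<partial>lborel) = (1::ennreal)" if "x \<noteq> 0" for x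
  proof -
    have "flow (-t) x \<in> shell \<longleftrightarrow> t \<in> {ln (nrm x) - 1<..ln (nrm x)}" for t
    proof -
      have "exp (-t) * nrm x = exp (ln (nrm x) - t)"
        using nrm_pos[OF that] by (simp add: exp_diff exp_minus field_simps)
      then show ?thesis
        unfolding shell_def mem_Collect_eq nrm_flow by auto
    qed
    then have "(\<integral>\<^sup>+t. indicator shell (flow (-t) x) \<partial>lborel)
       = (\<integral>\<^sup>+t. indicator {ln (nrm x) - 1<..ln (nrm x)} t \<partial>(lborel::real measure))"
      by (intro nn_integral_cong) (simp add: indicator_def)
    also have "\<dots> = 1" by simp
    finally show ?thesis .
  qed
  have "(\<integral>\<^sup>+x. F x \<partial>lborel) = (\<integral>\<^sup>+x. F x * (\<integral>\<^sup>+t. indicator shell (flow (-t) x) \<partial>lborel) \<partial>lborel)"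
    by (rule nn_integral_cong_AE, rule AE_mp[OF AE_lborel_singleton[of 0]]) (auto simp: one)
  also have "\<dots> = (\<integral>\<^sup>+x. (\<integral>\<^sup>+t. F x * indicator shell (flow (-t) x) \<partial>lborel) \<partial>lborel)"
    by (simp add: nn_integral_cmult)
  also have "\<dots> = (\<integral>\<^sup>+t. (\<integral>\<^sup>+x. F x * indicator shell (flow (-t) x) \<partial>lborel) \<partial>lborel)"
    by (rule lborel_pair.Fubini') measurable
  also have "\<dots> = (\<integral>\<^sup>+t. (\<integral>\<^sup>+y. F (flow t y) * ennreal (exp (hdim * t)) * indicator shell y \<partial>lborel) \<partial>lborel)"
  proof (rule nn_integral_cong)
    fix t :: real
    have "(\<integral>\<^sup>+x. F x * indicator shell (flow (-t) x) \<partial>lborel) =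
      ennreal (exp (hdim * t)) * (\<integral>\<^sup>+y. F (flow t y) * indicator shell y \<partial>lborel)"
      using nn_integral_flow[of "\<lambda>x. F x * indicator shell (flow (-t) x)" t] by (simp add: flow_flow flow_0)
    then show "(\<integral>\<^sup>+x. F x * indicator shell (flow (-t) x) \<partial>lborel) =
      (\<integral>\<^sup>+y. F (flow t y) * ennreal (exp (hdim * t)) * indicator shell y \<partial>lborel)"
      by (simp add: nn_integral_cmult[symmetric] mult_ac)
  qed
  also have "\<dots> = (\<integral>\<^sup>+y. (\<integral>\<^sup>+t. F (flow t y) * ennreal (exp (hdim * t)) * indicator shell y \<partial>lborel) \<partial>lborel)"
    by (rule lborel_pair.Fubini') measurable
  also have "\<dots> = (\<integral>\<^sup>+y\<in>shell. (\<integral>\<^sup>+t. F (flow t y) * ennreal (exp (hdim * t)) \<partial>lborel) \<partial>lborel)"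
    by (simp add: nn_integral_multc)
  finally show ?thesis .
qed

text \<open>
  The point of quasi-norm \<open>1\<close> on the orbit of \<open>y\<close>.
\<close>
definition unit :: "real^'n \<Rightarrow> real^'n" where "unit y = flow (- ln (nrm y)) y"

lemma nrm_unit: "y \<noteq> 0 \<Longrightarrow> nrm (unit y) = 1"
  using nrm_pos[of y] by (simp add: unit_def nrm_flow exp_minus)

lemma measurable_unit [measurable]: "unit \<in> borel_measurable borel"
  unfolding unit_def by measurable

lemma shell_nonzero: "y \<in> shell \<Longrightarrow> y \<noteq> 0"
  using nrm_eq_0[of 0] by (auto simp: shell_def)

text \<open>
  The substitution \<open>t = ln R - ln |y| - s\<close> on each orbit starts the clock at the boundary of the ball: then
  \<open>|x| = R exp (-s)\<close>, and the ball is exactly the part with \<open>s > 0\<close>.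
\<close>
lemma nn_integral_qball:
  assumes [measurable]: "F \<in> borel_measurable borel" and R: "R > 0"
  shows "(\<integral>\<^sup>+x\<in>qball nrm R. F x \<partial>lborel) =
    (\<integral>\<^sup>+y\<in>shell. ennreal (nrm y powr (- hdim)) *
       (\<integral>\<^sup>+s\<in>{0<..}. F (flow (ln R - s) (unit y)) * ennreal (exp (hdim * (ln R - s))) \<partial>lborel) \<partial>lborel)"
proof -
  have [measurable]: "qball nrm R \<in> sets borel" unfolding qball_def by measurable
  have "(\<integral>\<^sup>+t. F (flow t y) * indicator (qball nrm R) (flow t y) * ennreal (exp (hdim * t)) \<partial>lborel)
    = ennreal (nrm y powr (- hdim)) *
       (\<integral>\<^sup>+s\<in>{0<..}. F (flow (ln R - s) (unit y)) * ennreal (exp (hdim * (ln R - s))) \<partial>lborel)"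
    if "y \<in> shell" for y
  proof -
    note y0 = shell_nonzero[OF that]
    have "(\<integral>\<^sup>+t. F (flow t y) * indicator (qball nrm R) (flow t y) * ennreal (exp (hdim * t)) \<partial>lborel)
      = (\<integral>\<^sup>+s. (\<lambda>t. F (flow t y) * indicator (qball nrm R) (flow t y) * ennreal (exp (hdim * t))) ((ln R - ln (nrm y)) - s) \<partial>lborel)"
      by (rule nn_integral_lborel_reflect[symmetric]) measurable
    also have "\<dots> = (\<integral>\<^sup>+s. ennreal (nrm y powr (- hdim)) *
        (F (flow (ln R - s) (unit y)) * ennreal (exp (hdim * (ln R - s))) * indicator {0<..} s) \<partial>lborel)"
    proof (rule nn_integral_cong)
      fix s :: real
      have e: "flow (ln R - ln (nrm y) - s) y = flow (ln R - s) (unit y)"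
        by (simp add: unit_def flow_flow algebra_simps)
      have "nrm (flow (ln R - s) (unit y)) = R * exp (- s)"
        using R by (simp add: nrm_flow nrm_unit[OF y0] exp_diff exp_minus field_simps)
      then have i: "indicator (qball nrm R) (flow (ln R - s) (unit y)) = (indicator {0<..} s :: ennreal)"
        using R by (auto simp: qball_def indicator_def)
      have "exp (hdim * (ln R - ln (nrm y) - s)) = nrm y powr (- hdim) * exp (hdim * (ln R - s))"
        using nrm_pos[OF y0] by (simp add: powr_def algebra_simps flip: exp_add)
      then have "ennreal (exp (hdim * (ln R - ln (nrm y) - s))) = ennreal (nrm y powr (- hdim)) * ennreal (exp (hdim * (ln R - s)))"
        by (simp add: ennreal_mult)
      then show "(\<lambda>t. F (flow t y) * indicator (qball nrm R) (flow t y) * ennreal (exp (hdim * t))) ((ln R - ln (nrm y)) - s)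
        = ennreal (nrm y powr (- hdim)) * (F (flow (ln R - s) (unit y)) * ennreal (exp (hdim * (ln R - s))) * indicator {0<..} s)"
        unfolding e i by (simp add: mult_ac)
    qed
    also have "\<dots> = ennreal (nrm y powr (- hdim)) *
       (\<integral>\<^sup>+s\<in>{0<..}. F (flow (ln R - s) (unit y)) * ennreal (exp (hdim * (ln R - s))) \<partial>lborel)"
      by (rule nn_integral_cmult) measurable
    finally show ?thesis .
  qed
  then show ?thesis
    by (subst nn_integral_orbits) (auto intro!: nn_integral_cong simp: indicator_def)
qed

lemma norm_le_coords: "norm x \<le> (\<Sum>i\<in>UNIV. norm (column i P)) * (\<Sum>i\<in>UNIV. \<bar>(P' *v x) $ i\<bar>)"
proof -
  have "norm x = norm (flow 0 x)" by (simp add: flow_0)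
  also have "\<dots> \<le> (\<Sum>i\<in>UNIV. \<bar>(P' *v x) $ i\<bar> * norm (column i P))"
    unfolding flow_sum by (rule order_trans[OF norm_sum]) simp
  also have "\<dots> \<le> (\<Sum>i\<in>UNIV. \<bar>(P' *v x) $ i\<bar> * (\<Sum>i\<in>UNIV. norm (column i P)))"
    by (intro sum_mono mult_left_mono member_le_sum) auto
  finally show ?thesis by (subst mult.commute) (simp only: sum_distrib_right)
qed

text \<open>
  The set where the \<open>l\<^sup>1\<close>-norm \<open>N\<close> of the eigencoordinates equals \<open>1\<close> is compact, so \<open>nrm \<ge> m > 0\<close> there. A point \<open>x\<close>
  with \<open>N x > 1\<close> is contracted onto this set after a time \<open>t\<close>, and \<open>m \<le> exp (-t) * nrm x\<close> bounds \<open>t\<close>, hence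
  also \<open>N x\<close>, in terms of \<open>nrm x\<close>.
\<close>
lemma bounded_qball: "bounded (qball nrm r)"
proof -
  define N where "N x = (\<Sum>i\<in>UNIV. \<bar>(P' *v x) $ i\<bar>)" for x
  define K where "K = (\<Sum>i\<in>UNIV. norm (column i P))"
  have K: "norm x \<le> K * N x" for x
    unfolding K_def N_def by (rule norm_le_coords)
  have K0: "K \<ge> 0" by (simp add: K_def sum_nonneg)
  have contN: "continuous_on UNIV N"
    unfolding N_def
    by (intro continuous_intros continuous_on_component linear_continuous_on_compose[where g = "(*v) P'"]) auto
  have "closed {x. N x = 1}"
    using contN by (intro closed_Collect_eq continuous_on_const)
  moreover have "bounded {x. N x = 1}"
    using K by (intro boundedI[of _ K]) (metis mem_Collect_eq mult.right_neutral)
  ultimately have comp: "compact {x. N x = 1}"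
    by (simp add: compact_eq_bounded_closed)
  obtain m where m: "m > 0" "\<And>x. N x = 1 \<Longrightarrow> m \<le> nrm x"
  proof (cases "{x. N x = 1} = {}")
    case True
    then show ?thesis using that[of 1] by auto
  next
    case False
    then obtain z where z: "N z = 1" "\<And>x. N x = 1 \<Longrightarrow> nrm z \<le> nrm x"
      using continuous_attains_inf[OF comp False continuous_on_subset[OF cont_nrm]] by auto
    then have "z \<noteq> 0" by (auto simp: N_def)
    then show ?thesis using that[of "nrm z"] z nrm_pos by auto
  qed
  define b where "b = (\<Sum>i\<in>UNIV. lam i)"
  define a where "a = Min (range lam)"
  have a: "a > 0" "\<And>i. a \<le> lam i"
    using lam_pos by (auto simp: a_def)
  have b: "lam i \<le> b" for i
    unfolding b_def using lam_pos by (intro member_le_sum) (auto intro: less_imp_le)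
  have Nflow: "N (flow t x) = (\<Sum>i\<in>UNIV. exp (lam i * t) * \<bar>(P' *v x) $ i\<bar>)" for t x
    by (simp add: N_def coords_flow abs_mult)
  have bnd: "N x \<le> max 1 (exp (b * ln (max 1 (r / m))))" if x: "nrm x < r" for x
  proof (cases "N x \<le> 1")
    case True
    then show ?thesis by simp
  next
    case False
    define h where "h t = N (flow (-t) x)" for t
    have h0: "h 0 = N x" by (simp add: h_def flow_0)
    \<comment> \<open>All coordinates contract at least like \<open>exp (- a t)\<close>, so that at this time \<open>N\<close> is at most \<open>1\<close>.\<close>
    define t1 where "t1 = ln (N x) / a"
    have t1: "t1 \<ge> 0" using a False by (simp add: t1_def)
    have "h t1 \<le> (\<Sum>i\<in>UNIV. exp (- (a * t1)) * \<bar>(P' *v x) $ i\<bar>)"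
      unfolding h_def Nflow using a t1 by (intro sum_mono mult_right_mono) (auto intro: mult_right_mono)
    also have "\<dots> = exp (- (a * t1)) * N x" by (simp add: N_def sum_distrib_left)
    also have "\<dots> = 1" using a False by (simp add: t1_def exp_minus)
    finally have "h t1 \<le> 1" .
    moreover have "continuous_on {0..t1} h"
      unfolding h_def by (intro continuous_on_compose2[OF contN] continuous_intros) auto
    ultimately obtain t where t: "0 \<le> t" "h t = 1"
      using IVT2'[of h t1 1 0] False t1 h0 by auto
    have "m \<le> exp (-t) * nrm x"
      using m(2)[of "flow (-t) x"] t by (simp add: h_def nrm_flow)
    also have "\<dots> < exp (-t) * r" using x by simp
    finally have "exp t \<le> r / m"
      using m by (simp add: exp_minus field_simps)
    then have tt: "t \<le> ln (max 1 (r / m))"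
      by (subst ln_ge_iff) auto
    have "N x = N (flow t (flow (-t) x))" by (simp add: flow_flow flow_0)
    also have "\<dots> \<le> (\<Sum>i\<in>UNIV. exp (b * t) * \<bar>(P' *v flow (-t) x) $ i\<bar>)"
      unfolding Nflow using b t by (intro sum_mono mult_right_mono) (auto intro: mult_right_mono)
    also have "\<dots> = exp (b * t) * h t" by (simp add: h_def N_def sum_distrib_left)
    also have "\<dots> \<le> exp (b * ln (max 1 (r / m)))"
      using t tt a b[of undefined] lam_pos[of undefined] by (auto intro!: mult_left_mono)
    finally show ?thesis by simp
  qed
  have "norm x \<le> K * max 1 (exp (b * ln (max 1 (r / m))))" if "x \<in> qball nrm r" for x
    using order_trans[OF K mult_left_mono[OF bnd K0]] that by (simp add: qball_def)
  then show ?thesis by (rule boundedI)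
qed

end

section \<open>The Euler operator and the radial derivative\<close>

lemma diagonal_operator_pow:
  fixes P P' :: "real^'n^'n"
  assumes "diagonal_flow P P' lam" and A: "\<And>x. A x = P *v (\<chi> i. lam i * (P' *v x) $ i)"
  shows "((\<lambda>y. t *\<^sub>R A y) ^^ k) x = P *v (\<chi> i. (lam i * t) ^ k * (P' *v x) $ i)"
proof -
  interpret diagonal_flow P P' lam by fact
  have step: "t *\<^sub>R A (P *v y) = P *v (\<chi> i. lam i * t * y $ i)" for y
  proof -
    have "t *\<^sub>R A (P *v y) = t *\<^sub>R (P *v (\<chi> i. lam i * y $ i))"
      by (simp add: A matrix_vector_mul_assoc left_inverse)
    also have "\<dots> = P *v (t *\<^sub>R (\<chi> i. lam i * y $ i))"
      by (rule linear_cmul[symmetric]) simp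
    also have "t *\<^sub>R (\<chi> i. lam i * y $ i) = (\<chi> i. lam i * t * y $ i)"
      by (simp add: vec_eq_iff)
    finally show ?thesis .
  qed
  show ?thesis
  proof (induction k)
    case 0
    show ?case using flow_0[of x] by (simp add: flow_def)
  next
    case (Suc k)
    then show ?case by (simp add: step mult.assoc)
  qed
qed

text \<open>
  The exponential series of a diagonalisable operator converges to the exponential of each eigenvalue in
  the corresponding coordinate.
\<close>
lemma dilation_eq_flow:
  fixes P P' :: "real^'n^'n"
  assumes df: "diagonal_flow P P' lam" and A: "\<And>x. A x = P *v (\<chi> i. lam i * (P' *v x) $ i)"
  shows "dilation A r x = diagonal_flow.flow P P' lam (ln r) x"
proof -
  interpret diagonal_flow P P' lam by fact
  have "(\<lambda>k. \<Sum>i\<in>UNIV. ((lam i * ln r) ^ k /\<^sub>R fact k * (P' *v x) $ i) *\<^sub>R column i P) sums flow (ln r) x"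
    unfolding flow_sum
    by (intro sums_sum sums_scaleR_left sums_mult2 exp_converges)
  moreover have "(\<Sum>i\<in>UNIV. ((lam i * ln r) ^ k /\<^sub>R fact k * (P' *v x) $ i) *\<^sub>R column i P)
      = (1 / fact k) *\<^sub>R ((\<lambda>y. ln r *\<^sub>R A y) ^^ k) x" for k
    unfolding diagonal_operator_pow[OF assms]
    by (simp add: matrix_mult_sum scalar_mult_eq_scaleR scaleR_sum_right divide_inverse mult_ac)
  ultimately show ?thesis
    by (simp add: dilation_def sums_iff)
qed

context homogeneous_norm
begin

text \<open>
  The derivative of \<open>u\<close> along the generator \<open>A\<close> of the flow, which is \<open>|x|\<close> times the radial derivative.
  The factor \<open>|x|\<close> makes it continuous at the origin as well.
\<close>
definition euler :: "(real^'n \<Rightarrow> real) \<Rightarrow> real^'n \<Rightarrow> real" where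
  "euler u x = (\<Sum>i\<in>UNIV. lam i * (P' *v x) $ i * frechet_derivative u (at x) (column i P))"

lemma has_derivative_flow_time:
  "((\<lambda>t. flow t x) has_vector_derivative
     (\<Sum>i\<in>UNIV. (lam i * (P' *v flow t x) $ i) *\<^sub>R column i P)) (at t)"
  unfolding coords_flow unfolding flow_sum
  by (auto intro!: derivative_eq_intros simp: mult_ac)

lemma euler_flow_deriv:
  assumes "u differentiable_on UNIV"
  shows "((\<lambda>t. u (flow t x)) has_real_derivative euler u (flow t x)) (at t)"
proof -
  have "(u has_derivative frechet_derivative u (at (flow t x))) (at (flow t x))"
    using assms by (simp add: differentiable_on_def frechet_derivative_works)
  from vector_derivative_diff_chain_within[OF has_derivative_flow_time has_derivative_at_withinI[OF this]]
  have "((u \<circ> (\<lambda>t. flow t x)) has_vector_derivative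
     frechet_derivative u (at (flow t x)) (\<Sum>i\<in>UNIV. (lam i * (P' *v flow t x) $ i) *\<^sub>R column i P)) (at t)" .
  moreover have "linear (frechet_derivative u (at (flow t x)))"
    using assms by (intro linear_frechet_derivative) (simp add: differentiable_on_def)
  ultimately show ?thesis
    by (simp add: has_real_derivative_iff_has_vector_derivative euler_def linear_sum linear_cmul o_def)
qed

lemma continuous_euler:
  assumes "C_diff 1 u"
  shows "continuous_on UNIV (euler u)"
  using assms unfolding euler_def
  by (intro continuous_intros continuous_on_component linear_continuous_on_compose[where g = "(*v) P'"]) auto

text \<open>
  The coordinates of \<open>flow (ln R - s) z\<close> decay at least like \<open>exp (- a s)\<close>, where \<open>a\<close> is the least eigenvalue, uniformly
  on the unit sphere because that is bounded; the partial derivatives of \<open>u\<close> are bounded on the ball.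
\<close>
lemma euler_decay:
  assumes u: "C_diff 1 u" and R: "R > 0"
  obtains M a where "M \<ge> 0" "a > 0"
    "\<And>s z. s > 0 \<Longrightarrow> nrm z = 1 \<Longrightarrow> \<bar>euler u (flow (ln R - s) z)\<bar> \<le> M * exp (- a * s)"
proof -
  \<comment> \<open>The radius \<open>max 2 R\<close> makes \<open>C\<close> contain both the ball and the unit sphere.\<close>
  define C where "C = closure (qball nrm (max 2 R))"
  have C: "compact C" unfolding C_def using bounded_qball by (simp add: compact_closure)
  have sub: "x \<in> C" if "nrm x < max 2 R" for x
    unfolding C_def by (rule subsetD[OF closure_subset]) (simp add: qball_def that)
  have "\<exists>B. \<forall>x\<in>C. norm (f x) \<le> B" if "continuous_on UNIV f" for f :: "real^'n \<Rightarrow> real"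
  proof -
    have "compact (f ` C)" using C that by (intro compact_continuous_image) (auto intro: continuous_on_subset)
    then show ?thesis using compact_imp_bounded bounded_iff by (metis image_eqI)
  qed
  note bnd = this
  have "\<forall>i. \<exists>B. \<forall>x\<in>C. norm (frechet_derivative u (at x) (column i P)) \<le> B"
    using u by (intro allI bnd) simp
  then obtain B1 where B1: "\<And>i x. x \<in> C \<Longrightarrow> \<bar>frechet_derivative u (at x) (column i P)\<bar> \<le> B1 i"
    by (metis real_norm_def)
  have "\<forall>i. \<exists>B. \<forall>x\<in>C. norm ((P' *v x) $ i) \<le> B"
    by (intro allI bnd continuous_on_component linear_continuous_on_compose[where g = "(*v) P'"]) auto
  then obtain B2 where B2: "\<And>i x. x \<in> C \<Longrightarrow> \<bar>(P' *v x) $ i\<bar> \<le> B2 i"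
    by (metis real_norm_def)
  define a where "a = Min (range lam)"
  have a: "a > 0" "\<And>i. a \<le> lam i"
    using lam_pos by (auto simp: a_def)
  define M where "M = (\<Sum>i\<in>UNIV. lam i * (exp (lam i * ln R) * B2 i) * B1 i)"
  have z0: "0 \<in> C" using sub[of 0] nrm_eq_0[of 0] by simp
  have B0: "B1 i \<ge> 0" "B2 i \<ge> 0" for i
    using order_trans[OF abs_ge_zero B1[OF z0]] order_trans[OF abs_ge_zero B2[OF z0]] by auto
  show ?thesis
  proof (rule that[of M a])
    show "M \<ge> 0"
      unfolding M_def using B0 lam_pos by (intro sum_nonneg mult_nonneg_nonneg) (auto intro: less_imp_le)
    fix s :: real and z assume s: "s > 0" and z: "nrm z = 1"
    have "nrm (flow (ln R - s) z) = R * exp (- s)"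
      using R z by (simp add: nrm_flow exp_diff exp_minus field_simps)
    also have "\<dots> < R * 1" using R s by (intro mult_strict_left_mono) auto
    finally have x: "flow (ln R - s) z \<in> C" using sub by simp
    have zC: "z \<in> C" using sub z by simp
    have "\<bar>euler u (flow (ln R - s) z)\<bar> \<le>
       (\<Sum>i\<in>UNIV. \<bar>lam i * (P' *v flow (ln R - s) z) $ i * frechet_derivative u (at (flow (ln R - s) z)) (column i P)\<bar>)"
      unfolding euler_def by (rule sum_abs)
    also have "\<dots> \<le> (\<Sum>i\<in>UNIV. lam i * (exp (lam i * ln R) * B2 i) * B1 i * exp (- a * s))"
    proof (rule sum_mono)
      fix i
      have "\<bar>(P' *v flow (ln R - s) z) $ i\<bar> = exp (lam i * ln R) * exp (- (lam i * s)) * \<bar>(P' *v z) $ i\<bar>"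
        by (simp add: coords_flow abs_mult right_diff_distrib exp_diff exp_minus divide_inverse)
      also have "\<dots> \<le> exp (lam i * ln R) * exp (- a * s) * B2 i"
        using a s B2[OF zC] by (intro mult_mono) auto
      finally have "\<bar>(P' *v flow (ln R - s) z) $ i\<bar> \<le> exp (lam i * ln R) * exp (- a * s) * B2 i" .
      then have "lam i * \<bar>(P' *v flow (ln R - s) z) $ i\<bar> * \<bar>frechet_derivative u (at (flow (ln R - s) z)) (column i P)\<bar>
         \<le> lam i * (exp (lam i * ln R) * exp (- a * s) * B2 i) * B1 i"
        using B1[OF x] lam_pos[of i] B0 by (intro mult_mono) auto
      then show "\<bar>lam i * (P' *v flow (ln R - s) z) $ i * frechet_derivative u (at (flow (ln R - s) z)) (column i P)\<bar>
         \<le> lam i * (exp (lam i * ln R) * B2 i) * B1 i * exp (- a * s)"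
        using lam_pos[of i] by (simp add: abs_mult mult_ac)
    qed
    also have "\<dots> = M * exp (- a * s)" by (simp add: M_def sum_distrib_right)
    finally show "\<bar>euler u (flow (ln R - s) z)\<bar> \<le> M * exp (- a * s)" .
  qed (use a in auto)
qed

lemma nn_integral_exp_decay_finite:
  assumes "b > 0" shows "(\<integral>\<^sup>+s\<in>{0<..}. ennreal (exp (- b * s)) \<partial>lborel) < \<infinity>"
proof -
  have "(\<integral>\<^sup>+s\<in>{0<..}. ennreal (exp (- b * s)) \<partial>lborel) \<le> (\<integral>\<^sup>+s\<in>{0..}. ennreal (exp (- b * s)) \<partial>lborel)"
    by (intro nn_integral_mono) (auto simp: indicator_def)
  also have "\<dots> = ennreal (exp (- b * 0) / b)"
    by (rule nn_integral_has_integral_lebesgue'[OF _ has_integral_exp_minus_to_infinity[OF assms]]) simp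
  finally show ?thesis by (simp add: order.strict_trans1)
qed

lemma shell_weight_finite:
  "(\<integral>\<^sup>+y\<in>shell. ennreal (nrm y powr (- hdim)) \<partial>lborel) < \<infinity>"
proof -
  have hdim0: "hdim \<ge> 0" unfolding hdim_def using lam_pos by (intro sum_nonneg) (auto intro: less_imp_le)
  have "(\<integral>\<^sup>+y\<in>shell. ennreal (nrm y powr (- hdim)) \<partial>lborel) \<le> (\<integral>\<^sup>+y. indicator shell y \<partial>lborel)"
    using hdim0 by (intro nn_integral_mono)
      (auto simp: indicator_def shell_def powr_minus inverse_le_1_iff ge_one_powr_ge_zero)
  also have "\<dots> = emeasure lborel shell" by simp
  also have "\<dots> < \<infinity>"
    by (intro emeasure_bounded_finite bounded_subset[OF bounded_qball[of "exp 1"]]) (auto simp: shell_def qball_def)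
  finally show ?thesis .
qed

text \<open>
  Along a ray the volume factor \<open>exp (hdim * t)\<close> is the power \<open>hdim\<close> of the quasi-norm, so it cancels the weight
  \<open>|x| powr (- hdim)\<close> that all integrands of the theorem carry.
\<close>
lemma homogeneous_weight_cancel:
  assumes "nrm z = 1" "h \<ge> 0"
  shows "ennreal (h / nrm (flow t z) powr hdim) * ennreal (exp (hdim * t)) = ennreal h"
proof -
  have "nrm (flow t z) powr hdim = exp (hdim * t)"
    using assms by (simp add: nrm_flow powr_def mult.commute)
  then show ?thesis
    using assms by (simp flip: ennreal_mult)
qed

text \<open>
  On every ray the energy is at most that of an exponential, uniformly over the shell, which has finite weighted measure.
\<close>
lemma nn_integral_euler_finite:
  assumes u: "C_diff 1 u" and R: "R > 0"
  shows "(\<integral>\<^sup>+x\<in>qball nrm R. ennreal (\<bar>euler u x\<bar> powr hdim / nrm x powr hdim) \<partial>lborel) < \<infinity>"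
proof -
  have hdim: "hdim > 0" unfolding hdim_def using lam_pos by (intro sum_pos) auto
  have [measurable]: "euler u \<in> borel_measurable borel"
    using continuous_euler[OF u] by (rule borel_measurable_continuous_onI)
  obtain M a where Ma: "M \<ge> 0" "a > 0"
    "\<And>s z. s > 0 \<Longrightarrow> nrm z = 1 \<Longrightarrow> \<bar>euler u (flow (ln R - s) z)\<bar> \<le> M * exp (- a * s)"
    using euler_decay[OF u R] by metis
  define K where "K = (\<integral>\<^sup>+s\<in>{0<..}. ennreal (exp (- (a * hdim) * s)) \<partial>lborel)"
  have K: "K < \<infinity>" unfolding K_def using Ma hdim by (intro nn_integral_exp_decay_finite) simp
  have "(\<integral>\<^sup>+x\<in>qball nrm R. ennreal (\<bar>euler u x\<bar> powr hdim / nrm x powr hdim) \<partial>lborel) =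
    (\<integral>\<^sup>+y\<in>shell. ennreal (nrm y powr (- hdim)) *
       (\<integral>\<^sup>+s\<in>{0<..}. ennreal (\<bar>euler u (flow (ln R - s) (unit y))\<bar> powr hdim / nrm (flow (ln R - s) (unit y)) powr hdim)
          * ennreal (exp (hdim * (ln R - s))) \<partial>lborel) \<partial>lborel)"
    by (rule nn_integral_qball[OF _ R]) measurable
  also have "\<dots> \<le> (\<integral>\<^sup>+y\<in>shell. ennreal (nrm y powr (- hdim)) * (ennreal (M powr hdim) * K) \<partial>lborel)"
  proof (intro nn_integral_mono)
    fix y
    have "(\<integral>\<^sup>+s\<in>{0<..}. ennreal (\<bar>euler u (flow (ln R - s) (unit y))\<bar> powr hdim / nrm (flow (ln R - s) (unit y)) powr hdim)
          * ennreal (exp (hdim * (ln R - s))) \<partial>lborel)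
       \<le> (\<integral>\<^sup>+s. ennreal (M powr hdim) * (ennreal (exp (- (a * hdim) * s)) * indicator {0<..} s) \<partial>lborel)"
      if "y \<in> shell"
    proof (intro nn_integral_mono)
      fix s :: real
      note z = nrm_unit[OF shell_nonzero[OF that]]
      have "ennreal (\<bar>euler u (flow (ln R - s) (unit y))\<bar> powr hdim) \<le> ennreal (M powr hdim) * ennreal (exp (- (a * hdim) * s))"
        if "s > 0"
      proof -
        have "\<bar>euler u (flow (ln R - s) (unit y))\<bar> powr hdim \<le> (M * exp (- a * s)) powr hdim"
          using Ma(3)[OF that z] hdim by (intro powr_mono2) auto
        also have "\<dots> = M powr hdim * exp (- (a * hdim) * s)"
          using Ma by (simp add: powr_mult) (simp add: powr_def mult_ac)
        finally show ?thesis by (simp add: ennreal_mult[symmetric] ennreal_leI)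
      qed
      then show "ennreal (\<bar>euler u (flow (ln R - s) (unit y))\<bar> powr hdim / nrm (flow (ln R - s) (unit y)) powr hdim)
          * ennreal (exp (hdim * (ln R - s))) * indicator {0<..} s
        \<le> ennreal (M powr hdim) * (ennreal (exp (- (a * hdim) * s)) * indicator {0<..} s)"
        unfolding homogeneous_weight_cancel[OF z powr_ge_zero] by (auto simp: indicator_def)
    qed
    also have "(\<integral>\<^sup>+s. ennreal (M powr hdim) * (ennreal (exp (- (a * hdim) * s)) * indicator {0<..} s) \<partial>lborel)
      = ennreal (M powr hdim) * K"
      unfolding K_def by (rule nn_integral_cmult) measurable
    finally show "ennreal (nrm y powr (- hdim)) *
       (\<integral>\<^sup>+s\<in>{0<..}. ennreal (\<bar>euler u (flow (ln R - s) (unit y))\<bar> powr hdim / nrm (flow (ln R - s) (unit y)) powr hdim)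
          * ennreal (exp (hdim * (ln R - s))) \<partial>lborel) * indicator shell y
      \<le> ennreal (nrm y powr (- hdim)) * (ennreal (M powr hdim) * K) * indicator shell y"
      by (auto simp: indicator_def intro!: mult_left_mono)
  qed
  also have "\<dots> = (\<integral>\<^sup>+y. (ennreal (M powr hdim) * K) * (ennreal (nrm y powr (- hdim)) * indicator shell y) \<partial>lborel)"
    by (simp add: mult_ac)
  also have "\<dots> = (ennreal (M powr hdim) * K) * (\<integral>\<^sup>+y\<in>shell. ennreal (nrm y powr (- hdim)) \<partial>lborel)"
    by (rule nn_integral_cmult) measurable
  also have "\<dots> < \<infinity>"
    using K shell_weight_finite by (simp add: ennreal_mult_less_top)
  finally show ?thesis .
qed

end

section \<open>The inequality on the ball\<close>

lemma epowr_inverse_cancel: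
  assumes "p > 0"
  shows "epowr (epowr I (1 / p)) p = I"
proof (cases I)
  case (real r)
  then show ?thesis
    using assms by (simp add: epowr_def powr_powr)
next
  case top
  then show ?thesis by (simp add: epowr_def)
qed

lemma set_integrable_of_nn_integral:
  fixes f :: "'a::euclidean_space \<Rightarrow> real"
  assumes [measurable]: "f \<in> borel_measurable borel" "S \<in> sets borel" and f: "\<And>x. x \<in> S \<Longrightarrow> f x \<ge> 0"
    and fin: "(\<integral>\<^sup>+x\<in>S. ennreal (f x) \<partial>lborel) < \<infinity>"
  shows "set_integrable lborel S f"
    and "ennreal (LINT x:S|lborel. f x) = (\<integral>\<^sup>+x\<in>S. ennreal (f x) \<partial>lborel)"
    and "(LINT x:S|lborel. f x) \<ge> 0"
proof -
  have e: "(\<integral>\<^sup>+x. ennreal (indicator S x *\<^sub>R f x) \<partial>lborel) = (\<integral>\<^sup>+x\<in>S. ennreal (f x) \<partial>lborel)"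
    by (intro nn_integral_cong) (auto simp: indicator_def)
  have nn: "indicator S x *\<^sub>R f x \<ge> 0" for x
    using f by (auto simp: indicator_def)
  show int: "set_integrable lborel S f"
    unfolding set_integrable_def
    by (rule integrableI_nonneg) (use fin e nn in auto)
  show "ennreal (LINT x:S|lborel. f x) = (\<integral>\<^sup>+x\<in>S. ennreal (f x) \<partial>lborel)"
    using nn_integral_eq_integral[OF int[unfolded set_integrable_def]] nn
    unfolding set_lebesgue_integral_def e by simp
  show "(LINT x:S|lborel. f x) \<ge> 0"
    unfolding set_lebesgue_integral_def using nn by (intro integral_nonneg_AE) auto
qed

text \<open>
  For the support of a test function the margin makes the function vanish on an initial piece of every ray, as
  \<open>hardy_half_line\<close> requires near \<open>0\<close>.
\<close>
lemma compact_support_margin: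
  fixes nrm :: "'a::topological_space \<Rightarrow> real"
  assumes "compact K" "continuous_on UNIV nrm" "\<And>x. x \<in> K \<Longrightarrow> nrm x < R" "R > 0"
  obtains \<rho> where "0 < \<rho>" "\<rho> < R" "\<And>x. x \<in> K \<Longrightarrow> nrm x < \<rho>"
proof (cases "K = {}")
  case True
  then show ?thesis using that[of "R/2"] assms by auto
next
  case False
  then obtain z where z: "z \<in> K" "\<And>x. x \<in> K \<Longrightarrow> nrm x \<le> nrm z"
    using continuous_attains_sup[OF assms(1) False continuous_on_subset[OF assms(2)]] by auto
  show ?thesis
    by (rule that[of "(max 0 (nrm z) + R) / 2"]) (use z assms(3)[OF z(1)] assms(4) in \<open>force+\<close>)
qed

context homogeneous_norm
begin

text \<open>
  The function \<open>f\<^bsub>T,R\<^esub>\<close>, written with the flow: \<open>ln R - 1 / T\<close> is the logarithm of \<open>R exp (- 1 / T)\<close>.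
\<close>
definition log_profile :: "(real^'n \<Rightarrow> real) \<Rightarrow> real \<Rightarrow> real \<Rightarrow> real^'n \<Rightarrow> real" where
  "log_profile u T R x = T powr ((hdim - 1) / hdim) * u (flow (ln R - 1 / T) (unit x)) * ln (R / nrm x) powr ((hdim - 1) / hdim)"

definition hardy_density :: "(real^'n \<Rightarrow> real) \<Rightarrow> real \<Rightarrow> real^'n \<Rightarrow> real" where
  "hardy_density u R x = \<bar>u x\<bar> powr hdim / (nrm x powr hdim * ln (R / nrm x) powr hdim)"

definition remainder_density :: "(real^'n \<Rightarrow> real) \<Rightarrow> real \<Rightarrow> real \<Rightarrow> real^'n \<Rightarrow> real" where
  "remainder_density u T R x = \<bar>u x - log_profile u T R x\<bar> powr hdim /
      (nrm x powr hdim * \<bar>ln (R / nrm x)\<bar> powr hdim * \<bar>ln (T * ln (R / nrm x))\<bar> powr hdim)"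

lemma measurable_densities [measurable]:
  assumes [measurable]: "u \<in> borel_measurable borel"
  shows "hardy_density u R \<in> borel_measurable borel" "remainder_density u T R \<in> borel_measurable borel"
  unfolding hardy_density_def remainder_density_def log_profile_def by measurable

lemma unit_flow: "nrm z = 1 \<Longrightarrow> unit (flow t z) = z"
  by (simp add: unit_def nrm_flow flow_flow flow_0)

text \<open>
  On each ray all three integrands, multiplied by the volume factor, become those of \<open>hardy_half_line\<close>, because
  \<open>ln (R / |x|) = s\<close>. As the constant in that inequality does not depend on the ray, integrating over the shell preserves it.
\<close>
lemma hardy_qball:
  assumes u: "C_diff 1 u" and R: "R > 0" and T: "T > 0" and hdim: "hdim \<ge> 2"
    and \<rho>: "0 < \<rho>" "\<rho> < R" "\<And>x. nrm x \<ge> \<rho> \<Longrightarrow> u x = 0"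
  shows "ennreal (((hdim - 1) / hdim) powr hdim) * (\<integral>\<^sup>+x\<in>qball nrm R. ennreal (hardy_density u R x) \<partial>lborel)
      + ennreal (remainder_const hdim) * (\<integral>\<^sup>+x\<in>qball nrm R. ennreal (remainder_density u T R x) \<partial>lborel)
    \<le> (\<integral>\<^sup>+x\<in>qball nrm R. ennreal (\<bar>euler u x\<bar> powr hdim / nrm x powr hdim) \<partial>lborel)"
proof -
  have [measurable]: "qball nrm R \<in> sets borel" unfolding qball_def by measurable
  have diff: "u differentiable_on UNIV" using u by simp
  have contu: "continuous_on UNIV u"
    using diff by (rule differentiable_imp_continuous_on)
  then have [measurable]: "u \<in> borel_measurable borel"
    by (rule borel_measurable_continuous_onI)
  have [measurable]: "euler u \<in> borel_measurable borel"
    using continuous_euler[OF u] by (rule borel_measurable_continuous_onI)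
  define W where "W x = ((hdim - 1) / hdim) powr hdim * hardy_density u R x + remainder_const hdim * remainder_density u T R x" for x
  have [measurable]: "W \<in> borel_measurable borel" unfolding W_def by measurable
  have c0: "remainder_const hdim \<ge> 0" using hdim by (simp add: remainder_const_def)
  have nn: "hardy_density u R x \<ge> 0" "remainder_density u T R x \<ge> 0" for x
    by (simp_all add: hardy_density_def remainder_density_def)
  have "ennreal (((hdim - 1) / hdim) powr hdim) * (\<integral>\<^sup>+x\<in>qball nrm R. ennreal (hardy_density u R x) \<partial>lborel)
      + ennreal (remainder_const hdim) * (\<integral>\<^sup>+x\<in>qball nrm R. ennreal (remainder_density u T R x) \<partial>lborel)
     = (\<integral>\<^sup>+x\<in>qball nrm R. ennreal (W x) \<partial>lborel)"
    using nn c0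
    by (subst nn_integral_cmult[symmetric], measurable, subst nn_integral_cmult[symmetric], measurable,
        subst nn_integral_add[symmetric], measurable)
       (auto intro!: nn_integral_cong simp: W_def ennreal_mult ennreal_plus indicator_def)
  also have "\<dots> = (\<integral>\<^sup>+y\<in>shell. ennreal (nrm y powr (- hdim)) *
       (\<integral>\<^sup>+s\<in>{0<..}. ennreal (W (flow (ln R - s) (unit y))) * ennreal (exp (hdim * (ln R - s))) \<partial>lborel) \<partial>lborel)"
    by (rule nn_integral_qball[OF _ R]) measurable
  also have "\<dots> \<le> (\<integral>\<^sup>+y\<in>shell. ennreal (nrm y powr (- hdim)) *
       (\<integral>\<^sup>+s\<in>{0<..}. ennreal (\<bar>euler u (flow (ln R - s) (unit y))\<bar> powr hdim / nrm (flow (ln R - s) (unit y)) powr hdim)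
          * ennreal (exp (hdim * (ln R - s))) \<partial>lborel) \<partial>lborel)"
  proof (intro nn_integral_mono)
    fix y
    have "(\<integral>\<^sup>+s\<in>{0<..}. ennreal (W (flow (ln R - s) z)) * ennreal (exp (hdim * (ln R - s))) \<partial>lborel)
       \<le> (\<integral>\<^sup>+s\<in>{0<..}. ennreal (\<bar>euler u (flow (ln R - s) z)\<bar> powr hdim / nrm (flow (ln R - s) z) powr hdim)
          * ennreal (exp (hdim * (ln R - s))) \<partial>lborel)" if z: "nrm z = 1" for z
    proof -
      define g where "g s = u (flow (ln R - s) z)" for s
      define g' where "g' s = - euler u (flow (ln R - s) z)" for s
      have nrm: "nrm (flow (ln R - s) z) = R * exp (- s)" for s
        using R z by (simp add: nrm_flow exp_diff exp_minus field_simps)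
      have lg: "ln (R / nrm (flow (ln R - s) z)) = s" for s
      proof -
        have "R / nrm (flow (ln R - s) z) = exp s"
          unfolding nrm using R by (simp add: exp_minus field_simps)
        then show ?thesis by simp
      qed
      have D: "(g has_real_derivative g' s) (at s)" for s
      proof -
        have "((\<lambda>s. ln R - s) has_real_derivative -1) (at s)"
          by (auto intro!: derivative_eq_intros)
        from DERIV_chain2[OF euler_flow_deriv[OF diff] this, of z]
        show ?thesis by (simp add: g_def[abs_def] g'_def)
      qed
      have cg': "continuous_on UNIV g'"
        unfolding g'_def
        by (intro continuous_on_minus continuous_on_compose2[OF continuous_euler[OF u]] continuous_intros) auto
      \<comment> \<open>For \<open>s \<le> ln (R / \<rho>)\<close> the ray is still in the region \<open>|x| \<ge> \<rho>\<close>, where \<open>u\<close> vanishes.\<close>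
      have zero: "g s = 0" if "0 < s" "s \<le> ln (R / \<rho>)" for s
      proof -
        have "\<rho> = R * exp (- ln (R / \<rho>))" using R \<rho> by (simp add: exp_minus)
        also have "\<dots> \<le> R * exp (- s)" using R that by simp
        finally show ?thesis unfolding g_def by (intro \<rho>(3)) (simp add: nrm)
      qed
      have "ennreal (W (flow (ln R - s) z)) * ennreal (exp (hdim * (ln R - s))) = ennreal (hardy_integrand hdim T g s)" if "s > 0" for s
      proof -
        have prof: "log_profile u T R (flow (ln R - s) z) = T powr ((hdim - 1) / hdim) * g (1 / T) * s powr ((hdim - 1) / hdim)"
          unfolding log_profile_def lg unit_flow[OF z] g_def ..
        have "W (flow (ln R - s) z) = hardy_integrand hdim T g s / nrm (flow (ln R - s) z) powr hdim"
          using that unfolding W_def hardy_density_def remainder_density_def lg prof hardy_integrand_def g_def[of s, symmetric]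
          by (simp add: add_divide_distrib mult_ac)
        then show ?thesis
          using homogeneous_weight_cancel[OF z hardy_integrand_nonneg] hdim by simp
      qed
      then have "(\<integral>\<^sup>+s\<in>{0<..}. ennreal (W (flow (ln R - s) z)) * ennreal (exp (hdim * (ln R - s))) \<partial>lborel)
         = (\<integral>\<^sup>+s\<in>{0<..}. ennreal (hardy_integrand hdim T g s) \<partial>lborel)"
        by (intro nn_integral_cong) (auto simp: indicator_def)
      also have "\<dots> \<le> (\<integral>\<^sup>+s\<in>{0<..}. ennreal (\<bar>g' s\<bar> powr hdim) \<partial>lborel)"
        using R \<rho> by (intro hardy_half_line[OF hdim T _ D cg' zero]) auto
      also have "\<dots> = (\<integral>\<^sup>+s\<in>{0<..}. ennreal (\<bar>euler u (flow (ln R - s) z)\<bar> powr hdim / nrm (flow (ln R - s) z) powr hdim)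
          * ennreal (exp (hdim * (ln R - s))) \<partial>lborel)"
        unfolding homogeneous_weight_cancel[OF z powr_ge_zero] g'_def by simp
      finally show ?thesis .
    qed
    from this[OF nrm_unit[OF shell_nonzero]]
    show "ennreal (nrm y powr (- hdim)) *
       (\<integral>\<^sup>+s\<in>{0<..}. ennreal (W (flow (ln R - s) (unit y))) * ennreal (exp (hdim * (ln R - s))) \<partial>lborel) * indicator shell y
      \<le> ennreal (nrm y powr (- hdim)) *
       (\<integral>\<^sup>+s\<in>{0<..}. ennreal (\<bar>euler u (flow (ln R - s) (unit y))\<bar> powr hdim / nrm (flow (ln R - s) (unit y)) powr hdim)
          * ennreal (exp (hdim * (ln R - s))) \<partial>lborel) * indicator shell y"
      by (auto simp: indicator_def intro!: mult_left_mono)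
  qed
  also have "\<dots> = (\<integral>\<^sup>+x\<in>qball nrm R. ennreal (\<bar>euler u x\<bar> powr hdim / nrm x powr hdim) \<partial>lborel)"
    by (rule nn_integral_qball[OF _ R, symmetric]) measurable
  finally show ?thesis .
qed

text \<open>
  Both sides are \<open>0\<close> at the origin, so the identity holds everywhere and the radial derivative inherits
  measurability from the continuous function \<open>euler u\<close>.
\<close>
lemma radial_deriv_eq_euler:
  assumes A: "\<And>r x. dilation A r x = flow (ln r) x" and u: "u differentiable_on UNIV"
  shows "radial_deriv A nrm u x = euler u x / nrm x"
proof (cases "x = 0")
  case True
  then show ?thesis
    using nrm_eq_0[of 0] by (simp add: radial_deriv_def A flow_zero)
next
  case False
  note n = nrm_pos[OF False]
  have "dilation A (1 / nrm x) x = unit x"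
    using n by (simp add: A unit_def ln_div)
  moreover have "((\<lambda>\<rho>. u (flow (ln \<rho>) (unit x))) has_real_derivative euler u (flow (ln (nrm x)) (unit x)) * (1 / nrm x)) (at (nrm x))"
    using n by (intro DERIV_chain2[OF euler_flow_deriv[OF u]]) (auto intro!: derivative_eq_intros)
  moreover have "flow (ln (nrm x)) (unit x) = x"
    by (simp add: unit_def flow_flow flow_0)
  ultimately show ?thesis
    by (simp add: radial_deriv_def A DERIV_imp_deriv)
qed

lemma f_TR_eq_log_profile:
  assumes A: "\<And>r x. dilation A r x = flow (ln r) x" and "homogeneous_dimension A = hdim"
    and "R > 0"
  shows "f_TR A nrm u T R x = log_profile u T R x"
proof -
  have "dilation A (1 / nrm x) x = unit x"
    using nrm_pos[of x] by (cases "x = 0") (auto simp: A unit_def ln_div flow_zero)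
  moreover have "ln (R * exp (- 1 / T)) = ln R - 1 / T"
    using assms by (simp add: ln_mult)
  ultimately show ?thesis
    by (simp add: f_TR_def log_profile_def assms Let_def)
qed

end

theorem theorem4p1:
  fixes gmul :: "real ^ 'n \<Rightarrow> real ^ 'n \<Rightarrow> real ^ 'n"
    and ginv :: "real ^ 'n \<Rightarrow> real ^ 'n"
    and A :: "real ^ 'n \<Rightarrow> real ^ 'n"
    and nrm :: "real ^ 'n \<Rightarrow> real"
    and Q R :: real
  assumes "homogeneous_group gmul ginv A"
    and "Q = homogeneous_dimension A"
    and "Q \<ge> 2"
    and "homogeneous_quasi_norm ginv A nrm"
    and "R > 0"
  shows "\<exists>C>0. \<forall>u \<in> Cinf0 (qball nrm R).
    set_integrable lborel (qball nrm R) (\<lambda>x. \<bar>radial_deriv A nrm u x\<bar> powr Q) \<and>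
    set_integrable lborel (qball nrm R)
      (\<lambda>x. \<bar>u x\<bar> powr Q / (nrm x powr Q * ln (R / nrm x) powr Q)) \<and>
    ereal ((LINT x:qball nrm R|lborel. \<bar>radial_deriv A nrm u x\<bar> powr Q) -
           ((Q - 1) / Q) powr Q *
           (LINT x:qball nrm R|lborel.
              \<bar>u x\<bar> powr Q / (nrm x powr Q * ln (R / nrm x) powr Q)))
      \<ge> ereal C * enn2ereal (SUP T\<in>{0<..}. epowr (d_cH A nrm u T R) Q)"
proof -
  have dA: "diagonalisable A" "positive_operator A"
    using assms(1) by (auto simp: homogeneous_group_def homogeneous_group_axioms_def)
  obtain B where B: "linear A" "independent B" "span B = UNIV" "\<And>b. b \<in> B \<Longrightarrow> \<exists>c. A b = c *\<^sub>R b"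
    using dA(1) by (auto simp: diagonalisable_def)
  have "\<And>c v. v \<noteq> 0 \<Longrightarrow> A v = c *\<^sub>R v \<Longrightarrow> c > 0"
    using dA(2) by (auto simp: positive_operator_def)
  then obtain P P' :: "real^'n^'n" and lam where P: "diagonal_flow P P' lam"
    "\<And>x. A x = P *v (\<chi> i. lam i * (P' *v x) $ i)" "trace (matrix A) = (\<Sum>i\<in>UNIV. lam i)"
    using diagonalisable_positive_obtains[OF B] by metis
  interpret df: diagonal_flow P P' lam by fact
  have dil: "dilation A r x = df.flow (ln r) x" for r x
    by (rule dilation_eq_flow[OF P(1,2)])
  interpret homogeneous_norm P P' lam nrm
  proof unfold_locales
    show "nrm (df.flow t x) = exp t * nrm x" for t x
      using assms(4) dil[of "exp t" x] unfolding homogeneous_quasi_norm_def by (metis exp_gt_zero ln_exp)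
  qed (use assms(4) in \<open>auto simp: homogeneous_quasi_norm_def\<close>)
  have Q: "homogeneous_dimension A = df.hdim" "Q = df.hdim"
    using P(3) assms(2) by (auto simp: homogeneous_dimension_def df.hdim_def)
  define C where "C = remainder_const Q"
  have C: "C > 0" using assms(3) by (simp add: C_def remainder_const_def)
  have [measurable]: "qball nrm R \<in> sets borel" unfolding qball_def by measurable
  show ?thesis
  proof (intro exI[of _ C] conjI C ballI)
    fix u assume "u \<in> Cinf0 (qball nrm R)"
    then have u: "C_diff 1 u" and supp: "compact (closure {x. u x \<noteq> 0})" "closure {x. u x \<noteq> 0} \<subseteq> qball nrm R"
      by (auto simp: Cinf0_def smooth_def simp del: C_diff.simps)
    have lt: "nrm x < R" if "x \<in> closure {x. u x \<noteq> 0}" for x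
      using supp(2) that by (auto simp: qball_def)
    obtain \<rho> where \<rho>: "0 < \<rho>" "\<rho> < R" "\<And>x. x \<in> closure {x. u x \<noteq> 0} \<Longrightarrow> nrm x < \<rho>"
      using compact_support_margin[OF supp(1) cont_nrm lt assms(5)] by blast
    have u0: "u x = 0" if "nrm x \<ge> \<rho>" for x
    proof (rule ccontr)
      assume "u x \<noteq> 0"
      then have "x \<in> closure {x. u x \<noteq> 0}" by (intro subsetD[OF closure_subset]) simp
      then show False using \<rho>(3)[of x] that by simp
    qed
    have diff: "u differentiable_on UNIV" using u by simp
    have [measurable]: "u \<in> borel_measurable borel"
      using diff by (intro borel_measurable_continuous_onI differentiable_imp_continuous_on)
    have [measurable]: "euler u \<in> borel_measurable borel"
      using continuous_euler[OF u] by (rule borel_measurable_continuous_onI)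
    have rad: "\<bar>radial_deriv A nrm u x\<bar> powr Q = \<bar>euler u x\<bar> powr Q / nrm x powr Q" for x
      using nrm_nonneg[of x] by (simp add: radial_deriv_eq_euler[OF dil diff] powr_divide)
    define E where "E = (\<integral>\<^sup>+x\<in>qball nrm R. ennreal (\<bar>euler u x\<bar> powr Q / nrm x powr Q) \<partial>lborel)"
    define H where "H = (\<integral>\<^sup>+x\<in>qball nrm R. ennreal (hardy_density u R x) \<partial>lborel)"
    define I where "I T = (\<integral>\<^sup>+x\<in>qball nrm R. ennreal (remainder_density u T R x) \<partial>lborel)" for T
    define \<kappa> where "\<kappa> = ((Q - 1) / Q) powr Q"
    have \<kappa>: "\<kappa> > 0" using assms(3) by (simp add: \<kappa>_def)
    have E: "E < \<infinity>" unfolding E_def Q(2) by (rule nn_integral_euler_finite[OF u assms(5)])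
    have main: "ennreal \<kappa> * H + ennreal C * I T \<le> E" if "T > 0" for T
      unfolding \<kappa>_def H_def C_def I_def E_def Q(2)
      using assms(3) that by (intro hardy_qball[OF u assms(5) _ _ \<rho>(1,2) u0]) (auto simp: Q(2))
    \<comment> \<open>Finiteness of the Hardy term comes from the inequality itself; any value of \<open>T\<close> serves.\<close>
    have \<kappa>H: "ennreal \<kappa> * H \<le> E"
      using main[of 1] by (meson add_increasing2 order_trans order_refl zero_le zero_less_one)
    from order.strict_trans1[OF \<kappa>H E] have H: "H < \<infinity>"
      using \<kappa> by (auto simp: ennreal_mult_less_top)
    have hd: "\<bar>u x\<bar> powr Q / (nrm x powr Q * ln (R / nrm x) powr Q) = hardy_density u R x" for x
      by (simp add: hardy_density_def Q(2))
    have nnE: "0 \<le> \<bar>euler u x\<bar> powr Q / nrm x powr Q" and nnH: "0 \<le> hardy_density u R x" for x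
      by (simp_all add: hardy_density_def)
    have mE: "(\<lambda>x. \<bar>euler u x\<bar> powr Q / nrm x powr Q) \<in> borel_measurable borel" by measurable
    have mH: "hardy_density u R \<in> borel_measurable borel" by measurable
    note sE = set_integrable_of_nn_integral[OF mE _ nnE E[unfolded E_def], simplified]
    note sH = set_integrable_of_nn_integral[OF mH _ nnH H[unfolded H_def], simplified]
    show "set_integrable lborel (qball nrm R) (\<lambda>x. \<bar>radial_deriv A nrm u x\<bar> powr Q)"
      unfolding rad by (rule sE)
    show "set_integrable lborel (qball nrm R) (\<lambda>x. \<bar>u x\<bar> powr Q / (nrm x powr Q * ln (R / nrm x) powr Q))"
      unfolding hd by (rule sH)
    define e where "e = (LINT x:qball nrm R|lborel. \<bar>euler u x\<bar> powr Q / nrm x powr Q)"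
    define h where "h = (LINT x:qball nrm R|lborel. hardy_density u R x)"
    have e: "ennreal e = E" "e \<ge> 0" unfolding e_def E_def using sE by auto
    have h: "ennreal h = H" "h \<ge> 0" unfolding h_def H_def using sH by auto
    have dI: "epowr (d_cH A nrm u T R) Q = I T" if "T > 0" for T
      using assms(3,5) unfolding d_cH_def Let_def Q(1) Q(2)
      by (simp add: epowr_inverse_cancel f_TR_eq_log_profile[OF dil Q(1)] I_def remainder_density_def)
    have "\<kappa> * h \<le> e"
    proof -
      have "ennreal (\<kappa> * h) \<le> ennreal e"
        using \<kappa>H \<kappa> h(2) unfolding e(1) by (simp add: ennreal_mult h(1))
      then show ?thesis using e(2) by (simp add: ennreal_le_iff)
    qed
    have IT: "ennreal C * I T \<le> ennreal (e - \<kappa> * h)" if "T > 0" for T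
    proof -
      have "ennreal C * I T + ennreal (\<kappa> * h) \<le> ennreal e"
        using main[OF that] h \<kappa> e by (simp add: ennreal_mult add.commute)
      then have "ennreal C * I T \<le> ennreal e - ennreal (\<kappa> * h)"
        by (simp add: ennreal_le_minus_iff)
      then show ?thesis using h \<kappa> by (simp add: ennreal_minus)
    qed
    have "ennreal C * (SUP T\<in>{0<..}. epowr (d_cH A nrm u T R) Q) = (SUP T\<in>{0<..}. ennreal C * I T)"
      by (subst SUP_mult_left_ennreal) (auto intro!: SUP_cong simp: dI)
    also have "\<dots> \<le> ennreal (e - \<kappa> * h)"
      using IT by (intro SUP_least) auto
    finally have "enn2ereal (ennreal C * (SUP T\<in>{0<..}. epowr (d_cH A nrm u T R) Q)) \<le> enn2ereal (ennreal (e - \<kappa> * h))"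
      by (simp add: less_eq_ennreal.rep_eq)
    then show "ereal C * enn2ereal (SUP T\<in>{0<..}. epowr (d_cH A nrm u T R) Q) \<le>
      ereal ((LINT x:qball nrm R|lborel. \<bar>radial_deriv A nrm u x\<bar> powr Q) -
           ((Q - 1) / Q) powr Q *
           (LINT x:qball nrm R|lborel.
              \<bar>u x\<bar> powr Q / (nrm x powr Q * ln (R / nrm x) powr Q)))"
      unfolding rad hd e_def[symmetric] h_def[symmetric] \<kappa>_def[symmetric]
      using C \<open>\<kappa> * h \<le> e\<close> by (simp add: times_ennreal.rep_eq enn2ereal_ennreal)
  qed
qed

end
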